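(* Let $\mathcal{C}$ be a category of noncrossing (two-coloured) partitions. (1) If $I(\mathcal{C})=\mathbb{Z}^{*}$ and $S(\mathcal{C})=\mathbb{Z}_{s}$, then $\mathcal{G}(\mathcal{C})=\mathbb{Z}_{d}$ with $d=s/n$ if $J(\mathcal{C})=n\mathbb{Z}$. (2) If $I(\mathcal{C})=\{-1,1\}$ and $1\in J(\mathcal{C})$, then $\mathcal{G}(\mathcal{C})=\mathbb{Z}_{s}$ with $s=\min\{k\geqslant 1 : \beta_{1}^{\otimes k}\sim\emptyset\}$. (3) If $I(\mathcal{C})=\{-1,1\}$ and $1\notin J(\mathcal{C})$, then $\mathcal{G}(\mathcal{C})=\mathbb{Z}_{s}$ with $s=\min\{k\geqslant 1 : \beta_{2}^{\otimes k}\sim\emptyset\}$.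
   Context: **Partitions.** A (two-coloured) partition in $P^{\circ,\bullet}(k,l)$, $k,l\geqslant 0$, is a set partition of $k$ upper points and $l$ lower points (each row ordered from left to right) together with a colour, white ($\circ$) or black ($\bullet$), for each point. It is noncrossing if its blocks can be drawn by strings between the two rows without crossings; $NC^{\circ,\bullet}(k,l)$ is the set of noncrossing ones. A through-block is a block containing both upper and lower points; $t(p)$ is the number of through-blocks of $p$. Operations: $p\otimes q$ is horizontal concatenation ($p^{\otimes k}$ is the $k$-fold horizontal concatenation of $p$ with itself); for $p\in P^{\circ,\bullet}(k,l)$, $q\in P^{\circ,\bullet}(l,m)$ with the lower colouring of $p$ equal to the upper colouring of $q$, $qp\in P^{\circ,\bullet}(k,m)$ is vertical concatenation ($p$ on top of $q$, middle points and closed loops being removed); $p^{*}$ is the reflection in the horizontal axis (colours unchanged); a rotation moves the leftmost (resp. rightmost) point of one row to the left (resp. right) end of the other row, keeping its connections and inverting its colour; $\overline{p}$ is obtained by turning $p$ upside down via rotations (all points change row and colour). A category of partitions $\mathcal{C}$ is a set of coloured partitions stable under all these operations and containing the white identity (one upper and one lower point, both white, connected). It is a category of noncrossing partitions if all its elements are noncrossing. A partition $p\in P^{\circ,\bullet}(k,k)$ is projective if $pp=p=p^{*}$. For projective $p,q\in\mathcal{C}$, one writes $p\sim q$ if there is $r\in\mathcal{C}$ with $p=r^{*}r$ and $q=rr^{*}$. **The data.** For $k\geqslant1$, $\pi_k\in NC^{\circ,\bullet}(k,k)$ is the one-block partition with all points white and $\pi_{-k}=\overline{\pi}_k$ (all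 points black); $\pi_{0^+}\in NC^{\circ,\bullet}(2,2)$ is the one-block partition with both rows coloured $\circ\bullet$. Set $\mathbb{Z}^{*}=\mathbb{Z}\setminus\{0\}$ and $I(\mathcal{C})=\{k\in\mathbb{Z}^{*}:\pi_k\in\mathcal{C}\}$; this is always $\mathbb{Z}^*$ or $\{-1,1\}$. $S(\mathcal{C})$ is the set of $\sim$-classes of projective partitions of $\mathcal{C}$ consisting of one single (through-)block; it carries the involution $\overline{[p]}=[\overline{p}]$ and the fusion operation for which $[p]\ast[q]$ is the class of the one-block partition obtained by merging the two blocks of $p\otimes q$ if that partition is in $\mathcal{C}$, and takes the value "empty" otherwise. When $I(\mathcal{C})=\mathbb{Z}^{*}$, the map $k\mapsto[\pi_k]$ ($k\ne0$), $0\mapsto[\pi_{0^+}]$ is a surjection from $\mathbb{Z}$ to $S(\mathcal{C})$ sending addition to $\ast$ and identifying $S(\mathcal{C})$ with a quotient group $\mathbb{Z}_s$ of $\mathbb{Z}$, $1\leqslant s\leqslant\infty$; "$S(\mathcal{C})=\mathbb{Z}_s$" refers to this identification. Here $\mathbb{Z}_s$ is the cyclic group of order $s$, with $\mathbb{Z}_\infty=\mathbb{Z}$. For $k\geqslant1$, $\theta_k\in NC^{\circ,\bullet}(k,0)$ is the one-block partition with all points white, $\beta_k=\theta_k^{*}\theta_k\in NC^{\circ,\bullet}(k,k)$, $\beta_{-k}=\overline{\beta}_k$, and $\beta_0=\emptyset$ is the empty partition. Set $J(\mathcal{C})=\{k\in\mathbb{Z}:\beta_k\in\mathcal{C}\}$;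 when $I(\mathcal{C})=\mathbb{Z}^*$ it is of the form $n\mathbb{Z}$ for some integer $n\geqslant 0$. $\mathcal{G}(\mathcal{C})$ is the group, for the operation induced by $\otimes$, of $\sim$-classes of projective partitions $p\in\mathcal{C}$ with $t(p)=0$ (neutral element: the class of $\emptyset$; inverse of $[p]$: $[\overline{p}]$). For every integer $N\geqslant4$ it is isomorphic to the group of equivalence classes of one-dimensional representations, under tensor product, of the easy quantum group associated to $\mathcal{C}$ and $N$. Equalities of the form $\mathcal{G}(\mathcal{C})=\mathbb{Z}_m$ are isomorphisms of groups. A minimum over an empty set is read as $\infty$, and $\infty/n=\infty$ for $n\geqslant 1$.
   Formalization: In (1) with n=0, where s/n is undefined, the formal statement says G(C) is trivial. In (3) the formula is stated when β_2∈C; when β_2∉C it says G(C) is trivial, since reading the minimum as ∞ would be false (e.g. colour-compatible noncrossing pairings). *)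

theory Defs
  imports
    "HOL-Algebra.Elementary_Groups"
    "HOL-Library.Disjoint_Sets"
    "HOL-Library.Extended_Nat"
begin

section \<open>Two-coloured partitions\<close>

datatype colour = White | Black

fun inv_colour :: "colour \<Rightarrow> colour" where
  "inv_colour White = Black"
| "inv_colour Black = White"

text \<open>Points of each row are numbered from left to right, starting with 0.\<close>

datatype point = Up nat | Lo nat

datatype tcp = Tcp (ucol: "colour list") (lcol: "colour list") (blocks: "point set set")

definition points :: "tcp \<Rightarrow> point set" where
  "points p = Up ` {..<length (ucol p)} \<union> Lo ` {..<length (lcol p)}"

definition is_partition :: "tcp \<Rightarrow> bool" where
  "is_partition p \<longleftrightarrow> partition_on (points p) (blocks p)"

text \<open>
  The boundary position reads the upper row from left to right and then the lower row from right
  to left. Strings can be drawn between the rows without crossings iff no two different blocks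
  interlace in this order.
\<close>

fun bpos :: "tcp \<Rightarrow> point \<Rightarrow> nat" where
  "bpos p (Up i) = i"
| "bpos p (Lo j) = length (ucol p) + (length (lcol p) - 1 - j)"

definition noncrossing :: "tcp \<Rightarrow> bool" where
  "noncrossing p \<longleftrightarrow>
     (\<forall>A\<in>blocks p. \<forall>B\<in>blocks p. A \<noteq> B \<longrightarrow>
        \<not> (\<exists>a\<in>A. \<exists>b\<in>B. \<exists>c\<in>A. \<exists>d\<in>B.
             bpos p a < bpos p b \<and> bpos p b < bpos p c \<and> bpos p c < bpos p d))"

definition through_block :: "point set \<Rightarrow> bool" where
  "through_block B \<longleftrightarrow> (\<exists>i. Up i \<in> B) \<and> (\<exists>j. Lo j \<in> B)"

definition through_number :: "tcp \<Rightarrow> nat" where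
  "through_number p = card {B \<in> blocks p. through_block B}"

definition empty_part :: tcp where
  "empty_part = Tcp [] [] {}"

definition one_block :: "colour list \<Rightarrow> colour list \<Rightarrow> tcp" where
  "one_block u l = Tcp u l {points (Tcp u l {})}"

section \<open>Operations\<close>

fun shift_point :: "nat \<Rightarrow> nat \<Rightarrow> point \<Rightarrow> point" where
  "shift_point k l (Up i) = Up (k + i)"
| "shift_point k l (Lo j) = Lo (l + j)"

definition hconcat :: "tcp \<Rightarrow> tcp \<Rightarrow> tcp" where
  "hconcat p q = Tcp (ucol p @ ucol q) (lcol p @ lcol q)
     (blocks p \<union> (`) (shift_point (length (ucol p)) (length (lcol p))) ` blocks q)"

definition hpower :: "tcp \<Rightarrow> nat \<Rightarrow> tcp" where
  "hpower p k = (hconcat p ^^ k) empty_part"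

text \<open>
  Vertical concatenation. The three rows of the stacked diagram are indexed 0 (upper row of the
  top partition), 1 (the identified middle rows), 2 (lower row of the bottom partition). Two outer
  points are in the same block iff they are linked by a path of blocks of the two partitions.
  The product of \<open>q\<close> and \<open>p\<close> in the order \<open>q p\<close>, with \<open>p\<close> on top, is \<open>vcomp q p\<close>; it is only
  meaningful if \<open>lcol p = ucol q\<close>.
\<close>

fun top_row :: "point \<Rightarrow> nat \<times> nat" where
  "top_row (Up i) = (0, i)"
| "top_row (Lo j) = (1, j)"

fun bot_row :: "point \<Rightarrow> nat \<times> nat" where
  "bot_row (Up i) = (1, i)"
| "bot_row (Lo j) = (2, j)"

fun outer_row :: "point \<Rightarrow> nat \<times> nat" where
  "outer_row (Up i) = (0, i)"
| "outer_row (Lo j) = (2, j)"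

definition stacked :: "tcp \<Rightarrow> tcp \<Rightarrow> ((nat \<times> nat) \<times> (nat \<times> nat)) set" where
  "stacked q p =
     (\<Union>A\<in>blocks p. (top_row ` A) \<times> (top_row ` A)) \<union>
     (\<Union>B\<in>blocks q. (bot_row ` B) \<times> (bot_row ` B))"

definition vcomp :: "tcp \<Rightarrow> tcp \<Rightarrow> tcp" where
  "vcomp q p =
     (let X = points (Tcp (ucol p) (lcol q) {})
      in Tcp (ucol p) (lcol q)
           (X // {(x, y) \<in> X \<times> X. (outer_row x, outer_row y) \<in> (stacked q p)\<^sup>+}))"

fun flip_point :: "point \<Rightarrow> point" where
  "flip_point (Up i) = Lo i"
| "flip_point (Lo j) = Up j"

definition reflect :: "tcp \<Rightarrow> tcp" where
  "reflect p = Tcp (lcol p) (ucol p) ((`) flip_point ` blocks p)"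

text \<open>
  Rotations of the leftmost and of the rightmost upper point to the lower row (for a nonempty
  upper row). The rotations of lower points to the upper row are their mirror images.
\<close>

fun rot_left_point :: "point \<Rightarrow> point" where
  "rot_left_point (Up 0) = Lo 0"
| "rot_left_point (Up (Suc i)) = Up i"
| "rot_left_point (Lo j) = Lo (Suc j)"

definition rot_left_down :: "tcp \<Rightarrow> tcp" where
  "rot_left_down p =
     Tcp (tl (ucol p)) (inv_colour (hd (ucol p)) # lcol p) ((`) rot_left_point ` blocks p)"

fun rot_right_point :: "nat \<Rightarrow> nat \<Rightarrow> point \<Rightarrow> point" where
  "rot_right_point k l (Up i) = (if i = k - 1 then Lo l else Up i)"
| "rot_right_point k l (Lo j) = Lo j"

definition rot_right_down :: "tcp \<Rightarrow> tcp" where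
  "rot_right_down p =
     Tcp (butlast (ucol p)) (lcol p @ [inv_colour (last (ucol p))])
       ((`) (rot_right_point (length (ucol p)) (length (lcol p))) ` blocks p)"

definition rot_left_up :: "tcp \<Rightarrow> tcp" where
  "rot_left_up p = reflect (rot_left_down (reflect p))"

definition rot_right_up :: "tcp \<Rightarrow> tcp" where
  "rot_right_up p = reflect (rot_right_down (reflect p))"

text \<open>
  Turning upside down: all upper points pass to the left end of the lower row, and the original
  lower points, now the rightmost ones of that row, pass to the upper row.
\<close>

definition turn :: "tcp \<Rightarrow> tcp" where
  "turn p = (rot_right_up ^^ length (lcol p)) ((rot_left_down ^^ length (ucol p)) p)"

section \<open>Categories of partitions\<close>

definition partition_category :: "tcp set \<Rightarrow> bool" where
  "partition_category C \<longleftrightarrow>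
     (\<forall>p\<in>C. is_partition p) \<and>
     one_block [White] [White] \<in> C \<and>
     (\<forall>p\<in>C. \<forall>q\<in>C. hconcat p q \<in> C) \<and>
     (\<forall>p\<in>C. \<forall>q\<in>C. lcol p = ucol q \<longrightarrow> vcomp q p \<in> C) \<and>
     (\<forall>p\<in>C. reflect p \<in> C) \<and>
     (\<forall>p\<in>C. ucol p \<noteq> [] \<longrightarrow> rot_left_down p \<in> C \<and> rot_right_down p \<in> C) \<and>
     (\<forall>p\<in>C. lcol p \<noteq> [] \<longrightarrow> rot_left_up p \<in> C \<and> rot_right_up p \<in> C)"

definition nc_category :: "tcp set \<Rightarrow> bool" where
  "nc_category C \<longleftrightarrow> partition_category C \<and> (\<forall>p\<in>C. noncrossing p)"

text \<open>The product \<open>p p\<close> is only defined if both rows carry the same colours.\<close>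

definition projective :: "tcp \<Rightarrow> bool" where
  "projective p \<longleftrightarrow>
     is_partition p \<and> lcol p = ucol p \<and> vcomp p p = p \<and> reflect p = p"

definition sim :: "tcp set \<Rightarrow> tcp \<Rightarrow> tcp \<Rightarrow> bool" where
  "sim C p q \<longleftrightarrow> p \<in> C \<and> projective p \<and> q \<in> C \<and> projective q \<and>
     (\<exists>r\<in>C. p = vcomp (reflect r) r \<and> q = vcomp r (reflect r))"

definition sim_class :: "tcp set \<Rightarrow> tcp \<Rightarrow> tcp set" where
  "sim_class C p = {q. sim C p q}"

section \<open>The invariants of a category\<close>

text \<open>For \<open>k = 0\<close> this is the partition written with index \<open>0\<^sup>+\<close> in the literature; it does not
  enter \<open>I_set\<close>.\<close>

definition pi_part :: "int \<Rightarrow> tcp" where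
  "pi_part k =
     (if k > 0 then one_block (replicate (nat k) White) (replicate (nat k) White)
      else if k < 0 then turn (one_block (replicate (nat (-k)) White) (replicate (nat (-k)) White))
      else one_block [White, Black] [White, Black])"

definition I_set :: "tcp set \<Rightarrow> int set" where
  "I_set C = {k. k \<noteq> 0 \<and> pi_part k \<in> C}"

definition theta_part :: "nat \<Rightarrow> tcp" where
  "theta_part k = one_block (replicate k White) []"

definition beta_nat :: "nat \<Rightarrow> tcp" where
  "beta_nat k = vcomp (reflect (theta_part k)) (theta_part k)"

definition beta_part :: "int \<Rightarrow> tcp" where
  "beta_part k =
     (if k > 0 then beta_nat (nat k)
      else if k < 0 then turn (beta_nat (nat (-k)))
      else empty_part)"

definition J_set :: "tcp set \<Rightarrow> int set" where
  "J_set C = {k. beta_part k \<in> C}"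

definition single_through_block :: "tcp \<Rightarrow> bool" where
  "single_through_block p \<longleftrightarrow> (\<exists>B. blocks p = {B} \<and> through_block B)"

definition merged :: "tcp \<Rightarrow> tcp \<Rightarrow> tcp" where
  "merged p q = (let t = hconcat p q in Tcp (ucol t) (lcol t) {\<Union>(blocks t)})"

text \<open>
  The classes of one-block projective partitions with the fusion operation. The value "empty" of
  the operation is the empty set, which is not a class. The distinguished element is only
  used when it belongs to the carrier, i.e. when the category contains \<open>pi_part 0\<close>.
\<close>

definition S_fusion :: "tcp set \<Rightarrow> tcp set monoid" where
  "S_fusion C =
     \<lparr>carrier = {sim_class C p | p. p \<in> C \<and> projective p \<and> single_through_block p},
      mult = (\<lambda>A B. \<Union>p\<in>A. \<Union>q\<in>B. if merged p q \<in> C then sim_class C (merged p q) else {}),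
      one = sim_class C (pi_part 0)\<rparr>"

definition G_group :: "tcp set \<Rightarrow> tcp set monoid" where
  "G_group C =
     \<lparr>carrier = {sim_class C p | p. p \<in> C \<and> projective p \<and> through_number p = 0},
      mult = (\<lambda>A B. \<Union>p\<in>A. \<Union>q\<in>B. sim_class C (hconcat p q)),
      one = sim_class C empty_part\<rparr>"

text \<open>The cyclic group of order \<open>s \<ge> 1\<close>, where the one of order \<open>\<infinity>\<close> is the group of integers.\<close>

fun cyclic :: "enat \<Rightarrow> int monoid" where
  "cyclic (enat m) = integer_mod_group m"
| "cyclic \<infinity> = integer_group"

fun multiples :: "enat \<Rightarrow> int set" where
  "multiples (enat m) = {k. int m dvd k}"
| "multiples \<infinity> = {0}"

text \<open>
  \<open>S_is_cyclic C s\<close>: the map sending \<open>k\<close> to the class of \<open>pi_part k\<close> is an epimorphism from the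
  integers whose kernel is generated by \<open>s\<close> (trivial for \<open>s = \<infinity>\<close>), so that it identifies the
  fusion structure with the quotient of order \<open>s\<close> of the integers.
\<close>

definition S_is_cyclic :: "tcp set \<Rightarrow> enat \<Rightarrow> bool" where
  "S_is_cyclic C s \<longleftrightarrow>
     (\<lambda>k. sim_class C (pi_part k)) \<in> epi integer_group (S_fusion C) \<and>
     kernel integer_group (S_fusion C) (\<lambda>k. sim_class C (pi_part k)) = multiples s"

text \<open>The least \<open>k \<ge> 1\<close> such that the \<open>k\<close>-th horizontal power of \<open>p\<close> is equivalent to the empty
  partition; the infimum of the empty set is \<open>\<infinity>\<close>.\<close>

definition trivial_exponent :: "tcp set \<Rightarrow> tcp \<Rightarrow> enat" where
  "trivial_exponent C p = (INF k \<in> {k. 1 \<le> k \<and> sim C (hpower p k) empty_part}. enat k)"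

end

theory Submission
  imports Defs "HOL-Algebra.Multiplicative_Group"
begin

text \<open>
  A partition is encoded by two words of coloured letters carrying labels, a block being the set of
  points with a given label. Rotating the lower row up turns a category into a set of labelled words
  closed under cyclic rotation, insertion of one word of the set into another, and contraction of
  adjacent letters of opposite colours, which identifies their labels.

  A projective partition without through-blocks is of the form \<open>a\<^sup>* a\<close> for a word \<open>a\<close>, and
  \<open>a\<^sup>* a \<sim> b\<^sup>* b\<close> iff \<open>b\<^sup>* a \<in> C\<close>. So the classes form a group, and it remains to find in each class a
  power of a fixed generator. If all \<open>\<pi>\<^sub>k\<close> are in \<open>C\<close>, adjacent points can be merged, so that every
  word is equivalent to a one-block word, which contracts to some \<open>\<theta>\<^sub>k\<close>; moreover \<open>\<theta>\<^sub>k \<in> C\<close> iff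
  \<open>\<pi>\<^sub>k \<sim> \<pi>\<^sub>0\<close>. If \<open>\<beta>\<^sub>1 \<in> C\<close>, every point can be isolated, so that every word is equivalent to one made of
  singletons. Otherwise, by noncrossingness a word contains a block \<open>B\<close> of consecutive letters;
  then \<open>B\<^sup>* B \<in> C\<close>, and \<open>B\<close> contracts either to nothing or to a pair of equal colours, the other
  possibilities producing \<open>\<beta>\<^sub>1\<close> or \<open>\<pi>\<^sub>2\<close>. Such a pair commutes with all letters because \<open>\<beta>\<^sub>2 \<in> C\<close>.
\<close>

section \<open>Partitions given by labelled words\<close>

definition kerpart :: "'a set \<Rightarrow> ('a \<Rightarrow> 'b) \<Rightarrow> 'a set set" where
  "kerpart X f = (\<lambda>x. {y \<in> X. f y = f x}) ` X"

lemma kerpart_cong: "X = Y \<Longrightarrow> (\<And>x. x \<in> Y \<Longrightarrow> f x = g x) \<Longrightarrow> kerpart X f = kerpart Y g"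
  unfolding kerpart_def by (intro image_cong) auto

lemma kerpart_same_block:
  "x \<in> X \<Longrightarrow> y \<in> X \<Longrightarrow> f x = f y \<longleftrightarrow> (\<exists>B\<in>kerpart X f. x \<in> B \<and> y \<in> B)"
  unfolding kerpart_def by auto

lemma kerpart_eq_iff:
  "kerpart X f = kerpart X g \<longleftrightarrow> (\<forall>x\<in>X. \<forall>y\<in>X. f x = f y \<longleftrightarrow> g x = g y)"
proof
  assume "kerpart X f = kerpart X g"
  then show "\<forall>x\<in>X. \<forall>y\<in>X. f x = f y \<longleftrightarrow> g x = g y"
    by (simp add: kerpart_same_block)
next
  assume "\<forall>x\<in>X. \<forall>y\<in>X. f x = f y \<longleftrightarrow> g x = g y"
  then show "kerpart X f = kerpart X g"
    unfolding kerpart_def by (intro image_cong) auto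
qed

lemma kerpart_image:
  assumes "\<And>x. x \<in> X \<Longrightarrow> g (h x) = f x"
  shows "(`) h ` kerpart X f = kerpart (h ` X) g"
proof -
  have "h ` {y \<in> X. f y = f x} = {z \<in> h ` X. g z = g (h x)}" if "x \<in> X" for x
    using that assms by auto
  then show ?thesis
    unfolding kerpart_def image_image by (intro image_cong) auto
qed

lemma kerpart_Un:
  assumes "\<And>x y. x \<in> X \<Longrightarrow> y \<in> Y \<Longrightarrow> f x \<noteq> f y"
  shows "kerpart (X \<union> Y) f = kerpart X f \<union> kerpart Y f"
proof -
  have "{y \<in> X \<union> Y. f y = f x} = {y \<in> X. f y = f x}" if "x \<in> X" for x
    using that assms by auto metis
  moreover have "{y \<in> X \<union> Y. f y = f x} = {y \<in> Y. f y = f x}" if "x \<in> Y" for x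
    using that assms by auto
  ultimately show ?thesis
    unfolding kerpart_def image_Un by (intro arg_cong2[where f="(\<union>)"] image_cong) auto
qed

lemma quotient_ker: "X // {(x, y) \<in> X \<times> X. f x = f y} = kerpart X f"
proof -
  have "{(x, y) \<in> X \<times> X. f x = f y} `` {x} = {y \<in> X. f y = f x}" if "x \<in> X" for x
    using that by auto
  then show ?thesis by (auto simp: quotient_def kerpart_def)
qed

lemma partition_on_kerpart: "partition_on X (kerpart X f)"
  unfolding partition_on_def kerpart_def disjoint_def by auto

type_synonym 'a line = "(colour \<times> 'a) list"

definition labs :: "'a line \<Rightarrow> 'a set" where
  "labs xs = snd ` set xs"

definition relab :: "('a \<Rightarrow> 'b) \<Rightarrow> 'a line \<Rightarrow> 'b line" where
  "relab f = map (apsnd f)"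

definition bar :: "'a line \<Rightarrow> 'a line" where
  "bar xs = rev (map (apfst inv_colour) xs)"

fun lab :: "'a line \<Rightarrow> 'a line \<Rightarrow> point \<Rightarrow> 'a" where
  "lab us ls (Up i) = snd (us ! i)"
| "lab us ls (Lo j) = snd (ls ! j)"

definition pts :: "'a line \<Rightarrow> 'a line \<Rightarrow> point set" where
  "pts us ls = Up ` {..<length us} \<union> Lo ` {..<length ls}"

definition lpart :: "'a line \<Rightarrow> 'a line \<Rightarrow> tcp" where
  "lpart us ls = Tcp (map fst us) (map fst ls) (kerpart (pts us ls) (lab us ls))"

lemma inv_colour_inv_colour [simp]: "inv_colour (inv_colour c) = c"
  by (cases c) auto

lemma inv_colour_eq_iff [simp]: "inv_colour c = inv_colour d \<longleftrightarrow> c = d"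
  by (cases c; cases d) auto

lemma bar_simps [simp]:
  "bar [] = []"
  "bar ((c, x) # xs) = bar xs @ [(inv_colour c, x)]"
  "bar (xs @ ys) = bar ys @ bar xs"
  "bar (bar xs) = xs"
  "length (bar xs) = length xs"
  "labs (bar xs) = labs xs"
  unfolding bar_def labs_def
  by (simp_all add: rev_map[symmetric] apfst_def map_prod_def split_def image_image comp_def)

lemma relab_simps [simp]:
  "relab f [] = []"
  "relab f ((c, x) # xs) = (c, f x) # relab f xs"
  "relab f (xs @ ys) = relab f xs @ relab f ys"
  "relab f (bar xs) = bar (relab f xs)"
  "length (relab f xs) = length xs"
  "map fst (relab f xs) = map fst xs"
  "labs (relab f xs) = f ` labs xs"
  "relab f (relab g xs) = relab (f \<circ> g) xs"
  unfolding relab_def bar_def labs_def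
  by (simp_all add: rev_map apfst_def apsnd_def map_prod_def split_def image_image)

lemma labs_simps [simp]:
  "labs [] = {}"
  "labs ((c, x) # xs) = insert x (labs xs)"
  "labs (xs @ ys) = labs xs \<union> labs ys"
  unfolding labs_def by auto

lemma finite_labs [simp]: "finite (labs xs)"
  by (simp add: labs_def)

lemma relab_cong: "(\<And>x. x \<in> labs xs \<Longrightarrow> f x = g x) \<Longrightarrow> relab f xs = relab g xs"
  unfolding relab_def labs_def by (auto simp: apsnd_def map_prod_def split_def)

lemma relab_id: "(\<And>x. x \<in> labs xs \<Longrightarrow> f x = x) \<Longrightarrow> relab f xs = xs"
  using relab_cong[of xs f id] by (simp add: relab_def apsnd_def map_prod_def)

lemma snd_nth_labs: "i < length xs \<Longrightarrow> snd (xs ! i) \<in> labs xs"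
  by (simp add: labs_def)

lemma labsE:
  assumes "x \<in> labs xs" obtains i where "i < length xs" "snd (xs ! i) = x"
  using assms by (metis imageE in_set_conv_nth labs_def)

lemma nth_relab: "i < length xs \<Longrightarrow> snd (relab f xs ! i) = f (snd (xs ! i))"
  by (simp add: relab_def)

lemma pts_cases:
  assumes "p \<in> pts us ls"
  obtains i where "p = Up i" "i < length us" | j where "p = Lo j" "j < length ls"
  using assms unfolding pts_def by auto

lemma lpart_sel [simp]:
  "ucol (lpart us ls) = map fst us" "lcol (lpart us ls) = map fst ls"
  "points (lpart us ls) = pts us ls"
  "blocks (lpart us ls) = kerpart (pts us ls) (lab us ls)"
  by (simp_all add: lpart_def points_def pts_def)

lemma lab_in: "p \<in> pts us ls \<Longrightarrow> lab us ls p \<in> labs us \<union> labs ls"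
  by (auto simp: pts_def snd_nth_labs)

lemma lpart_eq_iff:
  "lpart us ls = lpart us' ls' \<longleftrightarrow>
     map fst us = map fst us' \<and> map fst ls = map fst ls' \<and>
     (\<forall>p\<in>pts us ls. \<forall>q\<in>pts us ls.
        lab us ls p = lab us ls q \<longleftrightarrow> lab us' ls' p = lab us' ls' q)"
proof (cases "map fst us = map fst us' \<and> map fst ls = map fst ls'")
  case True
  then have "pts us ls = pts us' ls'"
    unfolding pts_def by (metis length_map)
  with True kerpart_eq_iff[of "pts us ls" "lab us ls"]
  show ?thesis by (simp add: lpart_def)
qed (auto simp: lpart_def)

lemma lpart_relab:
  assumes "inj_on f (labs us \<union> labs ls)"
  shows "lpart (relab f us) (relab f ls) = lpart us ls"
proof -
  have "lab (relab f us) (relab f ls) p = f (lab us ls p)" if "p \<in> pts us ls" for p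
    using that by (auto simp: pts_def nth_relab)
  then show ?thesis
    using assms lab_in[of _ us ls]
    by (auto simp: lpart_def pts_def[of "relab _ _"] pts_def[symmetric] kerpart_eq_iff inj_on_eq_iff)
qed

lemma lpart_exists:
  assumes "is_partition p"
  obtains us ls :: "nat line" where "p = lpart us ls"
proof -
  let ?X = "points p"
  have part: "partition_on ?X (blocks p)" using assms by (simp add: is_partition_def)
  have "finite ?X" by (simp add: points_def)
  then have "finite (blocks p)" using part finite_elements by blast
  then obtain f :: "point set \<Rightarrow> nat" where f: "inj_on f (blocks p)"
    using finite_imp_inj_to_nat_seg by metis
  define g where "g x = f (THE B. B \<in> blocks p \<and> x \<in> B)" for x
  define us where "us = map (\<lambda>i. (ucol p ! i, g (Up i))) [0..<length (ucol p)]"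
  define ls where "ls = map (\<lambda>i. (lcol p ! i, g (Lo i))) [0..<length (lcol p)]"
  have the: "(THE B. B \<in> blocks p \<and> x \<in> B) = B" if "B \<in> blocks p" "x \<in> B" for x B
    using that part by (intro the_equality) (auto simp: partition_on_def disjoint_def)
  have g: "g x = f B" if "B \<in> blocks p" "x \<in> B" for x B
    using the[OF that] by (simp add: g_def)
  have sub: "x \<in> ?X" if "B \<in> blocks p" "x \<in> B" for x B
    using that part by (auto simp: partition_on_def)
  have cov: "\<exists>B\<in>blocks p. x \<in> B" if "x \<in> ?X" for x
    using that part by (auto simp: partition_on_def)
  have eqB: "{y \<in> ?X. g y = g x} = B" if "B \<in> blocks p" "x \<in> B" for x B
  proof -
    have "g y = g x \<longleftrightarrow> y \<in> B" if "y \<in> ?X" for y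
    proof -
      obtain B' where B': "B' \<in> blocks p" "y \<in> B'" using cov \<open>y \<in> ?X\<close> by blast
      then have "g y = g x \<longleftrightarrow> B' = B"
        using g B' \<open>B \<in> blocks p\<close> \<open>x \<in> B\<close> f by (auto simp: inj_on_eq_iff)
      also have "\<dots> \<longleftrightarrow> y \<in> B"
        using B' \<open>B \<in> blocks p\<close> the by blast
      finally show ?thesis .
    qed
    with sub that show ?thesis by auto
  qed
  have "blocks p = kerpart ?X g"
  proof (intro Set.equalityI subsetI)
    fix B assume B: "B \<in> blocks p"
    then obtain x where "x \<in> B" using part by (metis partition_onD3 equals0I)
    then show "B \<in> kerpart ?X g"
      using eqB[OF B] sub[OF B] unfolding kerpart_def by blast
  next
    fix B assume "B \<in> kerpart ?X g"
    then show "B \<in> blocks p" using cov eqB unfolding kerpart_def by auto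
  qed
  moreover have "kerpart ?X g = kerpart (pts us ls) (lab us ls)"
    by (rule kerpart_cong) (auto simp: points_def pts_def us_def ls_def)
  moreover have "map fst us = ucol p" "map fst ls = lcol p"
    by (auto simp: us_def ls_def comp_def map_nth)
  ultimately have "p = lpart us ls"
    by (cases p) (simp add: lpart_def)
  then show thesis by (rule that)
qed

lemma hconcat_lpart:
  assumes "(labs us \<union> labs ls) \<inter> (labs us' \<union> labs ls') = {}"
  shows "hconcat (lpart us ls) (lpart us' ls') = lpart (us @ us') (ls @ ls')"
proof -
  let ?s = "shift_point (length us) (length ls)"
  let ?X = "pts us ls" and ?Y = "?s ` pts us' ls'"
  let ?l = "lab (us @ us') (ls @ ls')"
  have XY: "pts (us @ us') (ls @ ls') = ?X \<union> ?Y"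
  proof -
    have *: "{..<m + n} = {..<m} \<union> (+) m ` {..<n}" for m n :: nat
      by (auto simp: image_iff Bex_def) (metis add_diff_inverse_nat add_less_cancel_left)
    show ?thesis
      unfolding pts_def by (auto simp: * image_Un image_image)
  qed
  have lX: "?l x = lab us ls x" if "x \<in> ?X" for x
    using that by (auto simp: pts_def nth_append)
  have lY: "?l (?s x) = lab us' ls' x" for x
    by (cases x) (auto simp: nth_append)
  have "kerpart (?X \<union> ?Y) ?l = kerpart ?X ?l \<union> kerpart ?Y ?l"
  proof (rule kerpart_Un)
    fix x y assume x: "x \<in> ?X" and "y \<in> ?Y"
    then obtain z where z: "z \<in> pts us' ls'" "y = ?s z" by auto
    show "?l x \<noteq> ?l y"
      using lX[OF x] lY[of z] lab_in[OF x] lab_in[OF z(1)] z(2) assms by auto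
  qed
  also have "kerpart ?X ?l = kerpart ?X (lab us ls)"
    using lX by (intro kerpart_cong) auto
  also have "kerpart ?Y ?l = (`) ?s ` kerpart (pts us' ls') (lab us' ls')"
    using lY by (intro kerpart_image[symmetric])
  finally show ?thesis by (simp add: hconcat_def XY lpart_def)
qed

lemma reflect_lpart [simp]: "reflect (lpart us ls) = lpart ls us"
proof -
  have "(`) flip_point ` kerpart (pts us ls) (lab us ls)
      = kerpart (flip_point ` pts us ls) (lab ls us)"
    by (rule kerpart_image) (auto simp: pts_def)
  also have "flip_point ` pts us ls = pts ls us"
    by (auto simp: pts_def image_Un image_image)
  finally show ?thesis by (simp add: reflect_def lpart_def)
qed

lemma rot_left_down_lpart [simp]:
  "rot_left_down (lpart ((c, x) # us) ls) = lpart us ((inv_colour c, x) # ls)"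
proof -
  have "(`) rot_left_point ` kerpart (pts ((c, x) # us) ls) (lab ((c, x) # us) ls)
      = kerpart (rot_left_point ` pts ((c, x) # us) ls) (lab us ((inv_colour c, x) # ls))"
  proof (rule kerpart_image)
    show "lab us ((inv_colour c, x) # ls) (rot_left_point p) = lab ((c, x) # us) ls p" for p
      by (cases p rule: rot_left_point.cases) auto
  qed
  also have "rot_left_point ` pts ((c, x) # us) ls = pts us ((inv_colour c, x) # ls)"
    by (auto simp: pts_def image_Un image_image lessThan_Suc_eq_insert_0)
  finally show ?thesis by (simp add: rot_left_down_def lpart_def)
qed

lemma rot_right_down_lpart [simp]:
  "rot_right_down (lpart (us @ [(c, x)]) ls) = lpart us (ls @ [(inv_colour c, x)])"
proof -
  let ?r = "rot_right_point (Suc (length us)) (length ls)"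
  let ?P = "pts (us @ [(c, x)]) ls"
  have "(`) ?r ` kerpart ?P (lab (us @ [(c, x)]) ls)
      = kerpart (?r ` ?P) (lab us (ls @ [(inv_colour c, x)]))"
    by (rule kerpart_image) (auto simp: pts_def nth_append)
  also have "?r ` ?P = pts us (ls @ [(inv_colour c, x)])"
  proof -
    have "?r ` Up ` {..<length us} = Up ` {..<length us}"
      unfolding image_image by (rule image_cong) auto
    then show ?thesis
      by (auto simp: pts_def image_Un image_image lessThan_Suc)
  qed
  finally show ?thesis by (simp add: rot_right_down_def lpart_def)
qed

lemma rot_left_up_lpart [simp]:
  "rot_left_up (lpart us ((c, x) # ls)) = lpart ((inv_colour c, x) # us) ls"
  by (simp add: rot_left_up_def)

lemma rot_right_up_lpart [simp]:
  "rot_right_up (lpart us (ls @ [(c, x)])) = lpart (us @ [(inv_colour c, x)]) ls"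
  by (simp add: rot_right_up_def)

lemma turn_lpart: "turn (lpart us ls) = lpart (bar ls) (bar us)"
proof -
  have 1: "(rot_left_down ^^ length us) (lpart us ls) = lpart [] (bar us @ ls)" for us ls :: "'a line"
    by (induction us arbitrary: ls) (auto simp: funpow_Suc_right simp del: funpow.simps)
  have 2: "(rot_right_up ^^ length ls) (lpart vs (us @ ls)) = lpart (vs @ bar ls) us"
    for us vs ls :: "'a line"
  proof (induction ls arbitrary: vs rule: rev_induct)
    case (snoc cx ls)
    have "rot_right_up (lpart vs ((us @ ls) @ [cx])) = lpart (vs @ bar [cx]) (us @ ls)"
      by (cases cx) (simp only: rot_right_up_lpart bar_simps append_Nil)
    with snoc[of "vs @ bar [cx]"] show ?case
      by (simp add: funpow_Suc_right del: funpow.simps)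
  qed simp
  show ?thesis using 1 2[of ls "[]" "bar us"] by (simp add: turn_def)
qed

text \<open>The labels of the bottom partition may be finer than those of the top one; identified
  bottom labels are linked through the middle row.\<close>

lemma vcomp_lpart:
  assumes mid: "map fst ms = map fst ms'"
    and g: "\<And>i. i < length ms \<Longrightarrow> snd (ms ! i) = g (snd (ms' ! i))"
    and cross: "\<And>y. y \<in> labs ls \<Longrightarrow> g y \<in> labs us \<Longrightarrow> y \<in> labs ms'"
    and low: "\<And>y z. y \<in> labs ls \<Longrightarrow> z \<in> labs ls \<Longrightarrow> g y = g z \<Longrightarrow> y = z \<or> y \<in> labs ms' \<and> z \<in> labs ms'"
  shows "vcomp (lpart ms' ls) (lpart us ms) = lpart us (relab g ls)"
proof -
  have len: "length ms' = length ms" using mid by (metis length_map)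
  let ?X = "pts us (relab g ls)"
  let ?S = "stacked (lpart ms' ls) (lpart us ms)"
  let ?l = "lab us (relab g ls)"
  define F :: "nat \<times> nat \<Rightarrow> 'a" where
    "F = (\<lambda>(r, i). if r = 0 then snd (us ! i) else if r = 1 then snd (ms ! i) else g (snd (ls ! i)))"
  have S: "(P, Q) \<in> ?S \<longleftrightarrow>
      (\<exists>x\<in>pts us ms. \<exists>y\<in>pts us ms. lab us ms x = lab us ms y \<and> P = top_row x \<and> Q = top_row y) \<or>
      (\<exists>x\<in>pts ms' ls. \<exists>y\<in>pts ms' ls. lab ms' ls x = lab ms' ls y \<and> P = bot_row x \<and> Q = bot_row y)"
    for P Q unfolding stacked_def kerpart_def lpart_sel by (auto; metis)
  have top: "(top_row x, top_row y) \<in> ?S"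
    if "x \<in> pts us ms" "y \<in> pts us ms" "lab us ms x = lab us ms y" for x y
    using that S by blast
  have bot: "(bot_row x, bot_row y) \<in> ?S"
    if "x \<in> pts ms' ls" "y \<in> pts ms' ls" "lab ms' ls x = lab ms' ls y" for x y
    using that S by blast
  have Ft: "F (top_row x) = lab us ms x" for x by (cases x) (auto simp: F_def)
  have Fb: "F (bot_row x) = g (lab ms' ls x)" if "x \<in> pts ms' ls" for x
    using that by (auto simp: F_def pts_def len g)
  have inv: "F P = F Q" if "(P, Q) \<in> ?S" for P Q
    using that unfolding S by (auto simp: Ft Fb)
  have inv': "F P = F Q" if "(P, Q) \<in> ?S\<^sup>+" for P Q
    using that by (induction rule: trancl_induct) (auto dest: inv)
  have Fo: "F (outer_row x) = ?l x" if "x \<in> ?X" for x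
    using that by (auto simp: F_def pts_def nth_relab)
  have low': "\<exists>i<length ms. (bot_row (Up i), outer_row (Lo j)) \<in> ?S \<and>
      (outer_row (Lo j), bot_row (Up i)) \<in> ?S \<and> snd (ms ! i) = g (snd (ls ! j))"
    if "j < length ls" "snd (ls ! j) \<in> labs ms'" for j
  proof -
    obtain i where i: "i < length ms'" "snd (ms' ! i) = snd (ls ! j)" using labsE[OF \<open>snd (ls ! j) \<in> labs ms'\<close>] by blast
    have o: "outer_row (Lo j) = bot_row (Lo j)" by simp
    have "Up i \<in> pts ms' ls" "Lo j \<in> pts ms' ls" using i that by (auto simp: pts_def)
    then have "(bot_row (Up i), outer_row (Lo j)) \<in> ?S" "(outer_row (Lo j), bot_row (Up i)) \<in> ?S"
      unfolding o using i by (auto intro!: bot simp del: bot_row.simps)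
    then show ?thesis using i g len by (intro exI[of _ i]) auto
  qed
  have con: "(outer_row x, outer_row y) \<in> ?S\<^sup>+" if xy: "x \<in> ?X" "y \<in> ?X" "?l x = ?l y" for x y
  proof -
    have UL: "(outer_row (Up i), outer_row (Lo j)) \<in> ?S\<^sup>+ \<and> (outer_row (Lo j), outer_row (Up i)) \<in> ?S\<^sup>+"
      if ij: "i < length us" "j < length ls" "snd (us ! i) = g (snd (ls ! j))" for i j
    proof -
      have "g (snd (ls ! j)) \<in> labs us" using snd_nth_labs[OF ij(1)] ij(3) by simp
      then have j: "snd (ls ! j) \<in> labs ms'" by (rule cross[OF snd_nth_labs[OF ij(2)]])
      then obtain k where k: "k < length ms" "(bot_row (Up k), outer_row (Lo j)) \<in> ?S"
        "(outer_row (Lo j), bot_row (Up k)) \<in> ?S" "snd (ms ! k) = g (snd (ls ! j))"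
        using low'[OF ij(2) j] by blast
      have "Up i \<in> pts us ms" "Lo k \<in> pts us ms" using k ij by (auto simp: pts_def)
      then have "(top_row (Up i), top_row (Lo k)) \<in> ?S" "(top_row (Lo k), top_row (Up i)) \<in> ?S"
        using k ij by (auto intro!: top simp del: top_row.simps)
      then have "(outer_row (Up i), bot_row (Up k)) \<in> ?S" "(bot_row (Up k), outer_row (Up i)) \<in> ?S"
        by simp_all
      with k(2,3) show ?thesis by (meson trancl.r_into_trancl trancl_into_trancl)
    qed
    have LL: "(outer_row (Lo i), outer_row (Lo j)) \<in> ?S\<^sup>+"
      if ij: "i < length ls" "j < length ls" "g (snd (ls ! i)) = g (snd (ls ! j))" for i j
    proof (cases "snd (ls ! i) = snd (ls ! j)")
      case True
      have "Lo i \<in> pts ms' ls" "Lo j \<in> pts ms' ls" using ij by (auto simp: pts_def)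
      then have "(bot_row (Lo i), bot_row (Lo j)) \<in> ?S"
        using True by (intro bot) auto
      then show ?thesis by auto
    next
      case False
      then have ij': "snd (ls ! i) \<in> labs ms'" "snd (ls ! j) \<in> labs ms'"
        using low[OF snd_nth_labs[OF ij(1)] snd_nth_labs[OF ij(2)] ij(3)] by auto
      then obtain k m where k: "k < length ms" "(outer_row (Lo i), bot_row (Up k)) \<in> ?S"
        "snd (ms ! k) = g (snd (ls ! i))" and m: "m < length ms"
        "(bot_row (Up m), outer_row (Lo j)) \<in> ?S" "snd (ms ! m) = g (snd (ls ! j))"
        using low'[OF ij(1) ij'(1)] low'[OF ij(2) ij'(2)] by blast
      have "Lo k \<in> pts us ms" "Lo m \<in> pts us ms" using k m by (auto simp: pts_def)
      then have "(top_row (Lo k), top_row (Lo m)) \<in> ?S"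
        using k m ij by (intro top) auto
      then have "(bot_row (Up k), bot_row (Up m)) \<in> ?S" by simp
      with k(2) m(2) show ?thesis by (meson trancl.r_into_trancl trancl_into_trancl)
    qed
    have UU: "(outer_row (Up i), outer_row (Up j)) \<in> ?S\<^sup>+"
      if "i < length us" "j < length us" "snd (us ! i) = snd (us ! j)" for i j
    proof -
      have "Up i \<in> pts us ms" "Up j \<in> pts us ms" using that by (auto simp: pts_def)
      then have "(top_row (Up i), top_row (Up j)) \<in> ?S"
        using that by (intro top) auto
      then show ?thesis by auto
    qed
    from xy show ?thesis
      by (elim pts_cases) (auto simp: nth_relab simp del: outer_row.simps intro: UU LL UL[THEN conjunct1] UL[THEN conjunct2])
  qed
  have "(outer_row x, outer_row y) \<in> ?S\<^sup>+ \<longleftrightarrow> ?l x = ?l y" if "x \<in> ?X" "y \<in> ?X" for x y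
    using con that Fo inv' by metis
  then have "{(x, y) \<in> ?X \<times> ?X. (outer_row x, outer_row y) \<in> ?S\<^sup>+} = {(x, y) \<in> ?X \<times> ?X. ?l x = ?l y}"
    by auto
  moreover have "points (Tcp (map fst us) (map fst ls) {}) = ?X"
    by (simp add: points_def pts_def)
  moreover note quotient_ker[of ?X ?l]
  ultimately show ?thesis
    by (simp add: vcomp_def Let_def lpart_def[of us "relab g ls"])
qed

lemma vcomp_lpart_same:
  assumes "labs us \<inter> labs ls \<subseteq> labs ms"
  shows "vcomp (lpart ms ls) (lpart us ms) = lpart us ls"
  using vcomp_lpart[of ms ms id ls us] assms relab_id[of ls id] by auto

lemma bar_fst: "map fst (bar xs) = rev (map inv_colour (map fst xs))"
  by (simp add: bar_def rev_map comp_def)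

lemma bar_snd: "map snd (bar xs) = rev (map snd xs)"
  by (simp add: bar_def rev_map comp_def)

lemma relab_snd: "map snd (relab f xs) = map f (map snd xs)"
  by (simp add: relab_def)

section \<open>Categories in terms of words\<close>

definition tag0 :: "nat \<Rightarrow> nat" where "tag0 x = 2 * x"
definition tag1 :: "nat \<Rightarrow> nat" where "tag1 x = 2 * x + 1"

lemma tags [simp]:
  "tag0 x = tag0 y \<longleftrightarrow> x = y" "tag1 x = tag1 y \<longleftrightarrow> x = y" "tag0 x \<noteq> tag1 y" "tag1 x \<noteq> tag0 y"
  unfolding tag0_def tag1_def by presburger+

definition side :: "nat line \<Rightarrow> nat line \<Rightarrow> nat line" where
  "side a b = relab tag0 a @ relab tag1 b"

lemma lpart_disjoint:
  assumes "inj_on f (labs a)" "inj_on g (labs b)" "f ` labs a \<inter> g ` labs b = {}"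
  shows "lpart (relab f a) (relab g b) = lpart (relab tag0 a) (relab tag1 b)"
proof -
  have *: "f x \<noteq> g y" if "x \<in> labs a" "y \<in> labs b" for x y using that assms(3) by auto
  then have **: "g y \<noteq> f x" if "x \<in> labs a" "y \<in> labs b" for x y using that by metis
  show ?thesis
    unfolding lpart_eq_iff using assms(1,2) * **
    by (auto simp: pts_def nth_relab inj_on_eq_iff snd_nth_labs)
qed

definition pairing :: "nat line \<Rightarrow> nat line \<Rightarrow> tcp" where
  "pairing a b = lpart (relab tag0 a) (relab tag1 b)"

lemma pairing_eqI:
  assumes "inj_on f (labs a)" "inj_on g (labs b)" "f ` labs a \<inter> g ` labs b = {}"
  shows "pairing a b = lpart (relab f a) (relab g b)"
  using lpart_disjoint[OF assms] by (simp add: pairing_def)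

lemma reflect_pairing: "reflect (pairing a b) = pairing b a"
  unfolding pairing_def reflect_lpart by (rule lpart_disjoint) (auto simp: inj_on_def)

lemma vcomp_pairing: "vcomp (pairing b c) (pairing a b) = pairing a c"
proof -
  define t :: "nat \<Rightarrow> nat \<Rightarrow> nat" where "t i x = 3 * x + i" for i x
  have t: "t i x = t j y \<longleftrightarrow> i = j \<and> x = y" if "i < 3" "j < 3" for i j x y
    using that unfolding t_def by presburger
  have p: "pairing u v = lpart (relab (t i) u) (relab (t j) v)" if "i < 3" "j < 3" "i \<noteq> j" for i j u v
    by (rule pairing_eqI) (use that t in \<open>auto simp: inj_on_def\<close>)
  show ?thesis
    unfolding p[of 0 1 a b, simplified] p[of 1 2 b c, simplified] p[of 0 2 a c, simplified]
    by (rule vcomp_lpart_same) (auto simp: t)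
qed

lemma lpart_eq_pairing: "labs us \<inter> labs ls = {} \<Longrightarrow> lpart us ls = pairing us ls"
  using pairing_eqI[of id us id ls] by (simp add: relab_id)

lemma pairing_eqD:
  assumes "pairing a b = pairing c d"
  shows "map fst a = map fst c" "map fst b = map fst d"
    "i < length a \<Longrightarrow> j < length a \<Longrightarrow> snd (a ! i) = snd (a ! j) \<longleftrightarrow> snd (c ! i) = snd (c ! j)"
    "i < length b \<Longrightarrow> j < length b \<Longrightarrow> snd (b ! i) = snd (b ! j) \<longleftrightarrow> snd (d ! i) = snd (d ! j)"
proof -
  note eq = assms[unfolded pairing_def lpart_eq_iff relab_simps]
  then show 1: "map fst a = map fst c" and 2: "map fst b = map fst d" by auto
  have len: "length a = length c" "length b = length d" using 1 2 by (metis length_map)+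
  have ker: "lab (relab tag0 a) (relab tag1 b) p = lab (relab tag0 a) (relab tag1 b) q \<longleftrightarrow>
      lab (relab tag0 c) (relab tag1 d) p = lab (relab tag0 c) (relab tag1 d) q"
    if "p \<in> pts (relab tag0 a) (relab tag1 b)" "q \<in> pts (relab tag0 a) (relab tag1 b)" for p q
    using eq that by blast
  show "snd (a ! i) = snd (a ! j) \<longleftrightarrow> snd (c ! i) = snd (c ! j)" if "i < length a" "j < length a"
    using ker[of "Up i" "Up j"] that len by (simp add: pts_def nth_relab)
  show "snd (b ! i) = snd (b ! j) \<longleftrightarrow> snd (d ! i) = snd (d ! j)" if "i < length b" "j < length b"
    using ker[of "Lo i" "Lo j"] that len by (simp add: pts_def nth_relab image_iff)
qed

lemma pairing_eqI2:
  assumes "map fst a = map fst c" "map fst b = map fst d"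
    "\<And>i j. i < length a \<Longrightarrow> j < length a \<Longrightarrow> snd (a ! i) = snd (a ! j) \<longleftrightarrow> snd (c ! i) = snd (c ! j)"
    "\<And>i j. i < length b \<Longrightarrow> j < length b \<Longrightarrow> snd (b ! i) = snd (b ! j) \<longleftrightarrow> snd (d ! i) = snd (d ! j)"
  shows "pairing a b = pairing c d"
proof -
  have len: "length a = length c" "length b = length d" using assms(1,2) by (metis length_map)+
  show ?thesis
    unfolding pairing_def lpart_eq_iff using assms len
    by (auto simp: nth_relab elim!: pts_cases)
qed

lemma pairing_self_cong: "pairing a a = pairing b b \<Longrightarrow> pairing a c = pairing b c"
  by (frule pairing_eqD(1)) (auto intro!: pairing_eqI2 simp: pairing_eqD(3)[of a a b b])

text \<open>In the square of \<open>lpart us ls\<close> the through-labels are kept and the others are doubled.\<close>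

definition sq :: "nat set \<Rightarrow> nat \<Rightarrow> nat \<Rightarrow> nat" where
  "sq T i x = (if x \<in> T then 3 * x else 3 * x + 1 + i)"

lemma sq_eq_iff:
  "i < 2 \<Longrightarrow> j < 2 \<Longrightarrow> sq T i x = sq T j y \<longleftrightarrow> x = y \<and> (x \<in> T \<or> i = j)"
  unfolding sq_def by (auto; presburger)

lemma square_lpart:
  "vcomp (lpart ls us) (lpart us ls) = lpart (relab (sq (labs ls) 0) us) (relab (sq (labs ls) 1) us)"
proof -
  have "lpart us ls = lpart (relab (sq (labs ls) 0) us) (relab (sq (labs ls) 0) ls)"
    by (rule lpart_relab[symmetric]) (auto simp: inj_on_def sq_eq_iff)
  moreover have "lpart ls us = lpart (relab (sq (labs ls) 1) ls) (relab (sq (labs ls) 1) us)"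
    by (rule lpart_relab[symmetric]) (auto simp: inj_on_def sq_eq_iff)
  moreover have "relab (sq (labs ls) 1) ls = relab (sq (labs ls) 0) ls"
    by (rule relab_cong) (auto simp: sq_def)
  moreover have "vcomp (lpart (relab (sq (labs ls) 0) ls) (relab (sq (labs ls) 1) us))
      (lpart (relab (sq (labs ls) 0) us) (relab (sq (labs ls) 0) ls))
      = lpart (relab (sq (labs ls) 0) us) (relab (sq (labs ls) 1) us)"
    by (rule vcomp_lpart_same) (auto simp: sq_eq_iff)
  ultimately show ?thesis by simp
qed

lemma square_lpart_disjoint:
  assumes "labs us \<inter> labs ls = {}"
  shows "vcomp (lpart ls us) (lpart us ls) = pairing us us"
  unfolding square_lpart
  by (rule pairing_eqI[symmetric]) (use assms in \<open>auto simp: inj_on_def sq_eq_iff\<close>)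

lemma side_Nil [simp]: "side [] a = relab tag1 a" "side a [] = relab tag0 a"
  by (simp_all add: side_def)

lemma hconcat_pairing: "hconcat (pairing a b) (pairing a' b') = pairing (side a a') (side b b')"
proof -
  have "pairing a b = lpart (relab (tag0 \<circ> tag0) a) (relab (tag1 \<circ> tag0) b)"
    "pairing a' b' = lpart (relab (tag0 \<circ> tag1) a') (relab (tag1 \<circ> tag1) b')"
    by (rule pairing_eqI; auto simp: inj_on_def)+
  then have "hconcat (pairing a b) (pairing a' b') =
      lpart (relab (tag0 \<circ> tag0) a @ relab (tag0 \<circ> tag1) a') (relab (tag1 \<circ> tag0) b @ relab (tag1 \<circ> tag1) b')"
    by (simp only:) (rule hconcat_lpart, auto)
  then show ?thesis by (simp add: pairing_def side_def)
qed

locale pcat =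
  fixes C :: "tcp set"
  assumes cat: "partition_category C"
begin

definition L :: "'a line \<Rightarrow> bool" where
  "L xs \<longleftrightarrow> lpart xs [] \<in> C"

lemma is_partition_mem: "p \<in> C \<Longrightarrow> is_partition p"
  using cat by (auto simp: partition_category_def)

lemma vcomp_closed: "p \<in> C \<Longrightarrow> q \<in> C \<Longrightarrow> lcol p = ucol q \<Longrightarrow> vcomp q p \<in> C"
  using cat by (auto simp: partition_category_def)

lemma reflect_closed: "lpart us ls \<in> C \<Longrightarrow> lpart ls us \<in> C"
  using cat unfolding partition_category_def by (metis reflect_lpart)

lemma rotate_left: "lpart ((c, x) # us) ls \<in> C \<longleftrightarrow> lpart us ((inv_colour c, x) # ls) \<in> C"
proof -
  have d: "rot_left_down p \<in> C" if "p \<in> C" "ucol p \<noteq> []" for p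
    using that cat by (auto simp: partition_category_def)
  have u: "rot_left_up p \<in> C" if "p \<in> C" "lcol p \<noteq> []" for p
    using that cat by (auto simp: partition_category_def)
  show ?thesis
    using d[of "lpart ((c, x) # us) ls"] u[of "lpart us ((inv_colour c, x) # ls)"] by auto
qed

lemma rotate_right: "lpart (us @ [(c, x)]) ls \<in> C \<longleftrightarrow> lpart us (ls @ [(inv_colour c, x)]) \<in> C"
proof -
  have d: "rot_right_down p \<in> C" if "p \<in> C" "ucol p \<noteq> []" for p
    using that cat by (auto simp: partition_category_def)
  have u: "rot_right_up p \<in> C" if "p \<in> C" "lcol p \<noteq> []" for p
    using that cat by (auto simp: partition_category_def)
  show ?thesis
    using d[of "lpart (us @ [(c, x)]) ls"] u[of "lpart us (ls @ [(inv_colour c, x)])"] by auto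
qed

lemma lpart_iff: "lpart us ls \<in> C \<longleftrightarrow> L (us @ bar ls)"
proof (induction ls arbitrary: us rule: rev_induct)
  case Nil
  then show ?case by (simp add: L_def)
next
  case (snoc cx ls)
  obtain c x where cx: "cx = (c, x)" by fastforce
  have "lpart us (ls @ [cx]) \<in> C \<longleftrightarrow> lpart (us @ [(inv_colour c, x)]) ls \<in> C"
    by (simp add: rotate_right cx)
  with snoc show ?case by (simp add: cx)
qed

lemma L_rotate: "L (us @ vs) \<longleftrightarrow> L (vs @ us)"
proof (induction us arbitrary: vs)
  case (Cons cx us)
  obtain c x where cx: "cx = (c, x)" by fastforce
  have "L ((cx # us) @ vs) \<longleftrightarrow> L ((us @ vs) @ [cx])"
    using rotate_left[of c x "us @ vs" "[]"] lpart_iff[of "us @ vs" "[(inv_colour c, x)]"]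
    by (simp add: L_def cx)
  with Cons[of "vs @ [cx]"] show ?case by simp
qed simp

lemma L_relab: "inj_on f (labs xs) \<Longrightarrow> L (relab f xs) \<longleftrightarrow> L xs"
  using lpart_relab[of f xs "[]"] by (simp add: L_def)

lemma L_insert:
  assumes "L (us @ vs)" "L ws" "labs ws \<inter> labs (us @ vs) = {}"
  shows "L (us @ ws @ vs)"
proof -
  have "lpart (vs @ us) [] \<in> C" "lpart ws [] \<in> C"
    using assms L_rotate by (auto simp: L_def)
  then have "hconcat (lpart (vs @ us) []) (lpart ws []) \<in> C"
    using cat by (simp add: partition_category_def)
  also have "hconcat (lpart (vs @ us) []) (lpart ws []) = lpart ((vs @ us) @ ws) []"
    using hconcat_lpart[of "vs @ us" "[]" ws "[]"] assms(3) by auto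
  finally show ?thesis using L_rotate[of vs "us @ ws"] by (simp add: L_def)
qed

lemma L_bar: "L (bar xs) \<longleftrightarrow> L xs"
  using reflect_closed[of xs "[]"] reflect_closed[of "[]" xs] lpart_iff[of "[]" xs] lpart_iff[of xs "[]"]
  by auto

lemma L_pair: "L [(c, x), (inv_colour c, x)]"
proof -
  have "lpart [(White, x)] [(White, x)] = one_block [White] [White]"
    by (auto simp: one_block_def lpart_def pts_def points_def kerpart_def)
  then have *: "L [(White, x), (Black, x)]"
    using lpart_iff[of "[(White, x)]" "[(White, x)]"] cat by (simp add: partition_category_def)
  with L_rotate[of "[(White, x)]" "[(Black, x)]"] show ?thesis by (cases c) auto
qed

lemma L_contract:
  assumes "L (us @ (c, x) # (inv_colour c, y) # vs)"
  shows "L (relab (id(y := x)) (us @ vs))"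
proof -
  define zs where "zs = vs @ us"
  let ?g = "id(y := x)" and ?m = "[(c, x), (inv_colour c, y)]"
  have "L (?m @ zs)" using assms L_rotate[of us "?m @ vs"] by (simp add: zs_def)
  then have 1: "lpart ?m (bar zs) \<in> C" by (simp add: lpart_iff)
  have 2: "lpart [] [(c, x), (inv_colour c, x)] \<in> C"
    using L_pair[of c x] by (simp add: lpart_iff)
  have "vcomp (lpart ?m (bar zs)) (lpart [] [(c, x), (inv_colour c, x)])
      = lpart [] (relab ?g (bar zs))"
    by (rule vcomp_lpart) (auto simp: less_Suc_eq split: if_splits)
  with vcomp_closed[OF 2 1] have "lpart [] (relab ?g (bar zs)) \<in> C" by simp
  then have "L (relab ?g vs @ relab ?g us)" by (simp add: lpart_iff zs_def)
  then show ?thesis using L_rotate by (metis relab_simps(3))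
qed

lemma L_contract_same:
  assumes "L (us @ (c, x) # (inv_colour c, x) # vs)"
  shows "L (us @ vs)"
  using L_contract[OF assms] by (simp add: relab_id)

lemma L_append_iff:
  fixes a b :: "nat line"
  assumes "inj_on f (labs a)" "inj_on g (labs b)" "f ` labs a \<inter> g ` labs b = {}"
  shows "L (relab f a @ relab g b) \<longleftrightarrow> L (side a b)"
  using lpart_disjoint[of f a g "bar b"] assms lpart_iff[of "relab f a" "relab g (bar b)"]
    lpart_iff[of "relab tag0 a" "relab tag1 (bar b)"]
  by (simp add: side_def)

definition lequiv :: "nat line \<Rightarrow> nat line \<Rightarrow> bool" where
  "lequiv a b \<longleftrightarrow> L (side a (bar b))"

lemma pairing_iff: "pairing a b \<in> C \<longleftrightarrow> lequiv a b"
  by (simp add: pairing_def lequiv_def side_def lpart_iff)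

lemma lequiv_iff:
  assumes "inj_on f (labs a)" "inj_on g (labs b)" "f ` labs a \<inter> g ` labs b = {}"
  shows "lequiv a b \<longleftrightarrow> L (relab f a @ bar (relab g b))"
  using L_append_iff[of f a g "bar b"] assms by (simp add: lequiv_def)

lemma pairing_sel [simp]: "ucol (pairing a b) = map fst a" "lcol (pairing a b) = map fst b"
  by (simp_all add: pairing_def)

lemma lequiv_trans: "lequiv a b \<Longrightarrow> lequiv b c \<Longrightarrow> lequiv a c"
  using vcomp_closed[of "pairing a b" "pairing b c"] by (simp add: vcomp_pairing pairing_iff)

lemma lequiv_sym: "lequiv a b \<Longrightarrow> lequiv b a"
  using reflect_closed reflect_pairing[of a b] by (metis pairing_def pairing_iff reflect_lpart)

lemma lequiv_refl: "lequiv a b \<Longrightarrow> lequiv a a"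
  using lequiv_sym lequiv_trans by blast

lemma lequiv_Nil: "lequiv a [] \<longleftrightarrow> L a"
  by (simp add: lequiv_def L_relab inj_on_def)

lemma lequiv_relab:
  assumes "inj_on f (labs a)" shows "lequiv (relab f a) b \<longleftrightarrow> lequiv a b"
proof -
  have "lequiv a b \<longleftrightarrow> L (relab (tag0 \<circ> f) a @ bar (relab tag1 b))"
    by (rule lequiv_iff) (use assms in \<open>auto simp: inj_on_def\<close>)
  then show ?thesis by (simp add: lequiv_def side_def)
qed

lemma lequiv_side:
  assumes "lequiv a a'" "lequiv b b'"
  shows "lequiv (side a b) (side a' b')"
proof -
  have "L (relab (tag0 \<circ> tag0) a @ bar (relab (tag1 \<circ> tag0) a'))"
    by (subst lequiv_iff[symmetric]) (use assms in \<open>auto simp: inj_on_def\<close>)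
  moreover have "L (relab (tag0 \<circ> tag1) b @ bar (relab (tag1 \<circ> tag1) b'))"
    by (subst lequiv_iff[symmetric]) (use assms in \<open>auto simp: inj_on_def\<close>)
  ultimately have "L (relab (tag0 \<circ> tag0) a @
      (relab (tag0 \<circ> tag1) b @ bar (relab (tag1 \<circ> tag1) b')) @ bar (relab (tag1 \<circ> tag0) a'))"
    by (rule L_insert) auto
  then show ?thesis by (simp add: lequiv_def side_def)
qed

lemma lequiv_bar: "lequiv a a \<Longrightarrow> lequiv (bar a) (bar a)"
proof -
  assume "lequiv a a"
  then have "L (bar (relab tag1 a) @ relab tag0 a)"
    using L_rotate[of "relab tag0 a"] by (simp add: lequiv_def side_def)
  then have "L (relab tag1 (bar a) @ bar (relab tag0 (bar a)))" by simp
  then show ?thesis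
    by (subst lequiv_iff[of tag1 _ tag0]) (auto simp: inj_on_def)
qed

lemma side_assoc: "side (side a b) c =
   relab (\<lambda>y. if even y then 2 * y else if even (y div 2) then y + 1 else y div 2) (side a (side b c))"
  by (auto simp: side_def tag0_def tag1_def intro!: relab_cong)

lemma lequiv_assoc:
  assumes "lequiv (side a (side b c)) (side a (side b c))"
  shows "lequiv (side (side a b) c) (side a (side b c))"
  unfolding side_assoc
  by (subst lequiv_relab[OF inj_onI]) (use assms in \<open>auto split: if_splits, presburger+\<close>)

subsection \<open>The group of classes\<close>

definition cls :: "nat line \<Rightarrow> tcp set" where
  "cls a = sim_class C (pairing a a)"

lemma is_partition_lpart: "is_partition (lpart us ls)"
  by (simp add: is_partition_def partition_on_kerpart)

lemma projective_pairing: "projective (pairing a a)"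
  by (simp add: projective_def vcomp_pairing reflect_pairing)
     (simp add: pairing_def is_partition_lpart)

lemma through_number_0:
  "through_number (lpart us ls) = 0 \<longleftrightarrow> labs us \<inter> labs ls = {}"
proof -
  have "finite (blocks (lpart us ls))" by (simp add: kerpart_def pts_def)
  then have "through_number (lpart us ls) = 0 \<longleftrightarrow> (\<forall>B\<in>blocks (lpart us ls). \<not> through_block B)"
    by (auto simp: through_number_def)
  also have "\<dots> \<longleftrightarrow> (\<forall>i<length us. \<forall>j<length ls. snd (us ! i) \<noteq> snd (ls ! j))"
  proof (intro iffI allI impI notI ballI)
    fix i j assume *: "\<forall>B\<in>blocks (lpart us ls). \<not> through_block B" "i < length us" "j < length ls"
      "snd (us ! i) = snd (ls ! j)"
    define B where "B = {y \<in> pts us ls. lab us ls y = lab us ls (Up i)}"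
    have "Up i \<in> pts us ls" using * by (simp add: pts_def)
    then have "B \<in> blocks (lpart us ls)" unfolding kerpart_def B_def lpart_sel by blast
    moreover have "Up i \<in> B" "Lo j \<in> B" using * by (auto simp: B_def pts_def)
    ultimately show False using * by (auto simp: through_block_def)
  next
    fix B assume *: "\<forall>i<length us. \<forall>j<length ls. snd (us ! i) \<noteq> snd (ls ! j)"
      "B \<in> blocks (lpart us ls)" "through_block B"
    then obtain i j x where "Up i \<in> B" "Lo j \<in> B" "B = {y \<in> pts us ls. lab us ls y = lab us ls x}"
      by (auto simp: through_block_def kerpart_def)
    then have "i < length us" "j < length ls" "snd (us ! i) = snd (ls ! j)" by (auto simp: pts_def)
    with * show False by blast
  qed
  also have "\<dots> \<longleftrightarrow> labs us \<inter> labs ls = {}"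
    by (metis disjoint_iff labsE snd_nth_labs)
  finally show ?thesis .
qed

lemma through_number_pairing: "through_number (pairing a b) = 0"
  by (auto simp: pairing_def through_number_0)

lemma projective_through_0:
  assumes "p \<in> C" "projective p" "through_number p = 0"
  obtains a where "p = pairing a a" "lequiv a a"
proof -
  obtain us ls :: "nat line" where p: "p = lpart us ls"
    using lpart_exists is_partition_mem assms(1) by metis
  have "labs us \<inter> labs ls = {}" using assms(3) p through_number_0 by metis
  then have pp: "p = pairing us ls" by (simp add: p lpart_eq_pairing)
  then have eq: "pairing ls us = pairing us ls"
    using assms(2) by (simp add: projective_def reflect_pairing)
  have "pairing us us = pairing us ls"
    by (rule pairing_eqI2) (use pairing_eqD[OF eq] in auto)
  with that[of us] pairing_iff[of us us] assms(1) pp show thesis by simp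
qed

lemma simE:
  assumes "sim C p q"
  obtains us ls :: "nat line" where "lpart us ls \<in> C" "p = vcomp (lpart ls us) (lpart us ls)"
    "q = vcomp (lpart us ls) (lpart ls us)" "q \<in> C" "projective q"
proof -
  obtain r where r: "r \<in> C" "p = vcomp (reflect r) r" "q = vcomp r (reflect r)" "q \<in> C" "projective q"
    using assms unfolding sim_def by blast
  obtain us ls :: "nat line" where "r = lpart us ls"
    using lpart_exists is_partition_mem[OF r(1)] by metis
  with r that show thesis by simp
qed

lemma sim_refl:
  assumes "p \<in> C" "projective p" shows "sim C p p"
proof -
  have "p = vcomp (reflect p) p \<and> p = vcomp p (reflect p)" using assms(2) by (simp add: projective_def)
  with assms show ?thesis unfolding sim_def by blast
qed

lemma sim_pairing:
  "sim C (pairing a a) q \<longleftrightarrow> (\<exists>c. q = pairing c c \<and> lequiv a c)"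
proof
  assume "\<exists>c. q = pairing c c \<and> lequiv a c"
  then obtain c where q: "q = pairing c c" "lequiv a c" by blast
  then have "lequiv a a" "lequiv c c" using lequiv_refl lequiv_sym by blast+
  then show "sim C (pairing a a) q"
    unfolding sim_def using q
    by (auto simp: projective_pairing pairing_iff reflect_pairing vcomp_pairing
        intro!: bexI[of _ "pairing a c"])
next
  assume "sim C (pairing a a) q"
  then obtain us ls :: "nat line" where r: "lpart us ls \<in> C"
    "pairing a a = vcomp (lpart ls us) (lpart us ls)" "q = vcomp (lpart us ls) (lpart ls us)"
    by (rule simE)
  have "through_number (lpart (relab (sq (labs ls) 0) us) (relab (sq (labs ls) 1) us)) = 0"
    using r(2) through_number_pairing by (metis square_lpart)
  then have disj: "labs us \<inter> labs ls = {}"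
    unfolding through_number_0 by (auto simp: sq_def)
  have "pairing a a = pairing us us"
    using r(2) square_lpart_disjoint[OF disj] by simp
  then have "pairing a ls = lpart us ls"
    unfolding lpart_eq_pairing[OF disj] by (rule pairing_self_cong)
  with r have "lequiv a ls" using pairing_iff by metis
  moreover have "q = pairing ls ls"
    using r(3) square_lpart_disjoint[of ls us] disj by (simp add: Int_commute)
  ultimately show "\<exists>c. q = pairing c c \<and> lequiv a c" by blast
qed

lemma cls_eq: "cls a = {pairing c c | c. lequiv a c}"
  by (auto simp: cls_def sim_class_def sim_pairing)

lemma cls_cong: "lequiv a b \<Longrightarrow> cls a = cls b"
  unfolding cls_eq using lequiv_trans lequiv_sym by blast

lemma cls_eq_iff:
  assumes "lequiv b b"
  shows "cls a = cls b \<longleftrightarrow> lequiv a b"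
proof
  assume "cls a = cls b"
  then have "pairing b b \<in> cls a" using assms by (auto simp: cls_eq)
  then obtain c where c: "pairing b b = pairing c c" "lequiv a c" by (auto simp: cls_eq)
  have "pairing b a = pairing c a" using c(1) by (rule pairing_self_cong)
  with c(2) show "lequiv a b" using lequiv_sym pairing_iff by metis
qed (rule cls_cong)

lemma G_carrier: "carrier (G_group C) = {cls a | a. lequiv a a}"
  unfolding G_group_def cls_def
  by (auto simp: projective_pairing through_number_pairing pairing_iff elim!: projective_through_0)

lemma G_one: "\<one>\<^bsub>G_group C\<^esub> = cls []"
proof -
  have "empty_part = pairing [] []"
    by (simp add: empty_part_def pairing_def lpart_def pts_def kerpart_def)
  then show ?thesis by (simp add: G_group_def cls_def)
qed

lemma G_mult:
  assumes "lequiv a a" "lequiv b b"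
  shows "cls a \<otimes>\<^bsub>G_group C\<^esub> cls b = cls (side a b)"
proof -
  have "sim_class C (hconcat p q) = cls (side a b)" if pq: "p \<in> cls a" "q \<in> cls b" for p q
  proof -
    obtain c d where cd: "p = pairing c c" "q = pairing d d" "lequiv a c" "lequiv b d"
      using pq unfolding cls_eq by blast
    then have "sim_class C (hconcat p q) = cls (side c d)"
      by (simp add: hconcat_pairing cls_def)
    with lequiv_side[OF cd(3,4)] show ?thesis using cls_cong by metis
  qed
  moreover have "pairing a a \<in> cls a" "pairing b b \<in> cls b" using assms by (auto simp: cls_eq)
  ultimately show ?thesis by (auto simp: G_group_def)
qed

lemma empty_L: "L ([] :: nat line)"
  using L_contract_same[of "[]" White 0 "[]"] L_pair[of White 0] by simp

lemma lequiv_empty: "lequiv [] []"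
  by (simp add: lequiv_Nil empty_L)

lemma lequiv_self_relab: "lequiv a a \<Longrightarrow> inj_on f (labs a) \<Longrightarrow> lequiv (relab f a) a"
  by (simp add: lequiv_relab)

lemma G_inverse:
  assumes "lequiv a a"
  shows "cls (bar a) \<otimes>\<^bsub>G_group C\<^esub> cls a = \<one>\<^bsub>G_group C\<^esub>"
proof -
  have "lequiv (bar a) (bar a)" using assms by (rule lequiv_bar)
  then have "lequiv (side (bar a) a) []"
    unfolding lequiv_Nil by (simp add: lequiv_def)
  from cls_cong[OF this] show ?thesis
    using assms lequiv_bar by (simp add: G_mult G_one)
qed

lemma group_G: "group (G_group C)"
proof (rule groupI)
  fix x y z assume "x \<in> carrier (G_group C)" "y \<in> carrier (G_group C)" "z \<in> carrier (G_group C)"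
  then obtain a b c where abc: "x = cls a" "y = cls b" "z = cls c" "lequiv a a" "lequiv b b" "lequiv c c"
    by (auto simp: G_carrier)
  then have "lequiv (side (side a b) c) (side a (side b c))"
    by (intro lequiv_assoc lequiv_side)
  from cls_cong[OF this] show "x \<otimes>\<^bsub>G_group C\<^esub> y \<otimes>\<^bsub>G_group C\<^esub> z = x \<otimes>\<^bsub>G_group C\<^esub> (y \<otimes>\<^bsub>G_group C\<^esub> z)"
    using abc by (simp add: G_mult lequiv_side)
next
  fix x assume "x \<in> carrier (G_group C)"
  then obtain a where a: "x = cls a" "lequiv a a" by (auto simp: G_carrier)
  then show "\<one>\<^bsub>G_group C\<^esub> \<otimes>\<^bsub>G_group C\<^esub> x = x"
    using cls_cong[OF lequiv_self_relab[of a tag1]]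
    by (simp add: G_one G_mult lequiv_empty inj_on_def)
  show "\<exists>y\<in>carrier (G_group C). y \<otimes>\<^bsub>G_group C\<^esub> x = \<one>\<^bsub>G_group C\<^esub>"
    using a G_inverse[of a] lequiv_bar[of a] unfolding G_carrier by blast
qed (auto simp: G_carrier G_one G_mult intro: lequiv_empty lequiv_side)

lemma G_inv:
  assumes "lequiv a a" shows "inv\<^bsub>G_group C\<^esub> cls a = cls (bar a)"
  using group.inv_equality[OF group_G G_inverse[OF assms]] assms lequiv_bar by (auto simp: G_carrier)

end

section \<open>Cyclic groups\<close>

lemma (in group) cyclic_iso_mod:
  assumes x: "x \<in> carrier G" and gen: "carrier G = range (\<lambda>k::int. x [^] k)"
  shows "G \<cong> integer_mod_group (ord x)"
proof -
  let ?Z = "integer_mod_group (ord x)"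
  have eq: "x [^] (k mod int (ord x)) = x [^] k" for k :: int
    using x by (subst int_pow_eq) (auto simp: mod_eq_dvd_iff[symmetric])
  have "(\<lambda>k::int. x [^] k) \<in> iso ?Z G"
  proof (intro isoI homI)
    show "bij_betw (\<lambda>k::int. x [^] k) (carrier ?Z) (carrier G)"
    proof (intro bij_betw_imageI inj_onI)
      fix i j assume ij: "i \<in> carrier ?Z" "j \<in> carrier ?Z" "x [^] i = x [^] j"
      then have "int (ord x) dvd j - i" using int_pow_eq x by blast
      then have "j mod int (ord x) = i mod int (ord x)" by (simp add: mod_eq_dvd_iff)
      with ij show "i = j"
        by (auto simp: carrier_integer_mod_group split: if_splits)
    next
      have "x [^] k \<in> (\<lambda>k::int. x [^] k) ` carrier ?Z" for k :: int
      proof (cases "ord x = 0")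
        case False
        then have "k mod int (ord x) \<in> carrier ?Z" by (simp add: carrier_integer_mod_group)
        with eq[of k] show ?thesis by (metis image_eqI)
      qed (simp add: carrier_integer_mod_group)
      then show "(\<lambda>k::int. x [^] k) ` carrier ?Z = carrier G" unfolding gen by blast
    qed
  qed (use x in \<open>auto simp: eq int_pow_mult\<close>)
  then show ?thesis
    using group.iso_sym[OF group_integer_mod_group] by (auto simp: is_iso_def)
qed

lemma (in group) int_pow_additive:
  fixes f :: "int \<Rightarrow> 'a"
  assumes "\<And>j. f j \<in> carrier G" "\<And>j k. f (j + k) = f j \<otimes> f k"
  shows "f j = f 1 [^] j"
proof -
  have "group_hom integer_group G f"
    using assms by (intro group_hom.intro group_hom_axioms.intro homI) (auto simp: is_group)
  from group_hom.hom_int_pow[OF this, of 1 j] show ?thesis by simp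
qed

section \<open>One-block words\<close>

definition mono_line :: "'a \<Rightarrow> colour list \<Rightarrow> 'a line" where
  "mono_line x = map (\<lambda>c. (c, x))"

lemma mono_line_simps [simp]:
  "mono_line x [] = []" "mono_line x (c # w) = (c, x) # mono_line x w"
  "mono_line x (v @ w) = mono_line x v @ mono_line x w"
  "map fst (mono_line x w) = w" "length (mono_line x w) = length w"
  "relab f (mono_line x w) = mono_line (f x) w"
  "bar (mono_line x w) = mono_line x (rev (map inv_colour w))"
  "labs (mono_line x w) = (if w = [] then {} else {x})"
  "mono_line x w = [] \<longleftrightarrow> w = []"
  by (auto simp: mono_line_def relab_def bar_def labs_def rev_map comp_def image_image image_constant_conv)

fun deg :: "colour list \<Rightarrow> int" where
  "deg [] = 0"
| "deg (White # w) = deg w + 1"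
| "deg (Black # w) = deg w - 1"

definition std :: "int \<Rightarrow> colour list" where
  "std k = replicate (nat \<bar>k\<bar>) (if 0 \<le> k then White else Black)"

lemma deg_append [simp]: "deg (v @ w) = deg v + deg w"
  by (induction v rule: deg.induct) auto

lemma deg_std [simp]: "deg (std k) = k"
proof -
  have "deg (replicate n White) = int n" "deg (replicate n Black) = - int n" for n
    by (induction n) auto
  then show ?thesis by (auto simp: std_def)
qed

lemma std_0 [simp]: "std 0 = []"
  by (simp add: std_def)

lemma std_White: "std (k + 1) = (if 0 \<le> k then White # std k else tl (std k))"
proof (cases "0 \<le> k")
  case True
  then have "nat \<bar>k + 1\<bar> = Suc (nat \<bar>k\<bar>)" by simp
  with True show ?thesis by (simp add: std_def)
next
  case False
  then have "nat \<bar>k\<bar> = Suc (nat \<bar>k + 1\<bar>)" by simp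
  with False show ?thesis by (auto simp: std_def)
qed

lemma std_Black: "std (k - 1) = (if k \<le> 0 then Black # std k else tl (std k))"
proof (cases "k \<le> 0")
  case True
  then have "nat \<bar>k - 1\<bar> = Suc (nat \<bar>k\<bar>)" by simp
  with True show ?thesis by (auto simp: std_def)
next
  case False
  then have "nat \<bar>k\<bar> = Suc (nat \<bar>k - 1\<bar>)" by simp
  with False show ?thesis by (auto simp: std_def)
qed

lemma std_neg: "k < 0 \<Longrightarrow> std k = Black # tl (std k)"
  by (cases "nat \<bar>k\<bar>") (auto simp: std_def)

lemma std_pos: "0 < k \<Longrightarrow> std k = White # tl (std k)"
  by (cases "nat \<bar>k\<bar>") (auto simp: std_def)

lemma bar_std: "rev (map inv_colour (std k)) = std (- k)"
  by (auto simp: std_def)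

lemma std_Nil_iff [simp]: "std k = [] \<longleftrightarrow> k = 0"
  by (auto simp: std_def)

lemma one_block_eq: "u \<noteq> [] \<or> l \<noteq> [] \<Longrightarrow> one_block u l = lpart (mono_line x u) (mono_line x l)"
proof -
  assume ne: "u \<noteq> [] \<or> l \<noteq> []"
  have "lab (mono_line x u) (mono_line x l) p = x" if "p \<in> pts (mono_line x u) (mono_line x l)" for p
    using that by (auto simp: pts_def mono_line_def)
  then have "kerpart (pts (mono_line x u) (mono_line x l)) (lab (mono_line x u) (mono_line x l))
      = kerpart (pts (mono_line x u) (mono_line x l)) (\<lambda>_. x)"
    by (intro kerpart_cong) auto
  also have "\<dots> = {pts (mono_line x u) (mono_line x l)}"
    using ne by (auto simp: kerpart_def pts_def)
  finally have "kerpart (pts (mono_line x u) (mono_line x l)) (lab (mono_line x u) (mono_line x l))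
      = {pts (mono_line x u) (mono_line x l)}" .
  moreover have "pts (mono_line x u) (mono_line x l) = points (Tcp u l {})"
    by (simp add: pts_def points_def)
  ultimately show ?thesis by (simp add: one_block_def lpart_def)
qed

definition theta :: "int \<Rightarrow> nat line" where
  "theta k = mono_line 0 (std k)"

lemma theta_0 [simp]: "theta 0 = []"
  by (simp add: theta_def)

lemma pi_part_eq: "k \<noteq> 0 \<Longrightarrow> pi_part k = lpart (theta k) (theta k)"
proof -
  assume "k \<noteq> 0"
  have *: "one_block (replicate (nat i) White) (replicate (nat i) White) = lpart (theta i) (theta i)" if "0 < i" for i
    using one_block_eq[of "std i" "std i" 0] that by (simp add: theta_def std_def)
  show ?thesis
  proof (cases "0 < k")
    case False
    with \<open>k \<noteq> 0\<close> have "pi_part k = turn (lpart (theta (- k)) (theta (- k)))"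
      using *[of "- k"] by (simp add: pi_part_def)
    then show ?thesis by (simp add: turn_lpart theta_def bar_std)
  qed (simp add: pi_part_def *)
qed

lemma beta_part_eq: "beta_part k = pairing (theta k) (theta k)"
proof -
  have *: "beta_nat (nat i) = pairing (theta i) (theta i)" if "0 < i" for i
  proof -
    have "theta_part (nat i) = lpart (theta i) []"
      using one_block_eq[of "std i" "[]" 0] that by (simp add: theta_part_def theta_def std_def)
    then show ?thesis
      using square_lpart_disjoint[of "theta i" "[]"] by (simp add: beta_nat_def)
  qed
  consider "k = 0" | "0 < k" | "k < 0" by linarith
  then show ?thesis
  proof cases
    case 1
    then show ?thesis by (simp add: beta_part_def empty_part_def pairing_def lpart_def pts_def kerpart_def)
  next
    case 2
    then show ?thesis by (simp add: beta_part_def *)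
  next
    case 3
    then have "beta_part k = turn (pairing (theta (- k)) (theta (- k)))"
      using *[of "- k"] by (simp add: beta_part_def)
    also have "\<dots> = lpart (relab tag1 (theta k)) (relab tag0 (theta k))"
      by (simp add: pairing_def turn_lpart theta_def bar_std)
    also have "\<dots> = pairing (theta k) (theta k)"
      by (rule pairing_eqI[symmetric]) (auto simp: inj_on_def)
    finally show ?thesis .
  qed
qed

section \<open>Noncrossing words\<close>

lemma interval_block:
  fixes s :: "nat \<Rightarrow> 'a"
  assumes "0 < n" and nc: "\<And>i j k l. i < j \<Longrightarrow> j < k \<Longrightarrow> k < l \<Longrightarrow> l < n \<Longrightarrow>
    s i = s k \<Longrightarrow> s j = s l \<Longrightarrow> s i = s j"
  obtains i k where "i \<le> k" "k < n" "\<And>j. j < n \<Longrightarrow> s j = s i \<longleftrightarrow> i \<le> j \<and> j \<le> k"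
proof -
  define P where "P = (\<lambda>(i, k). i \<le> k \<and> k < n \<and> s i = s k \<and> (\<forall>j<n. s j = s i \<longrightarrow> i \<le> j \<and> j \<le> k))"
  have hull: "\<exists>i k. P (i, k) \<and> i \<le> j \<and> j \<le> k \<and> s i = s j" if "j < n" for j
  proof -
    define A where "A = {i. i < n \<and> s i = s j}"
    have fin: "finite A" and ne: "A \<noteq> {}" using that by (auto simp: A_def)
    have "Min A \<in> A" "Max A \<in> A" using fin ne by auto
    moreover have "\<And>i. i \<in> A \<Longrightarrow> Min A \<le> i \<and> i \<le> Max A" using fin by simp
    moreover have "j \<in> A" using that by (simp add: A_def)
    ultimately show ?thesis
      by (intro exI[of _ "Min A"] exI[of _ "Max A"]) (auto simp: A_def P_def)
  qed
  obtain p where "P p" using hull[OF assms(1)] by blast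
  then obtain q where "P q" and minq: "\<And>r. P r \<Longrightarrow> snd q - fst q \<le> snd r - fst r"
    using ex_has_least_nat[of P p "\<lambda>r. snd r - fst r"] by blast
  obtain i k where q: "q = (i, k)" by fastforce
  have ik: "i \<le> k" "k < n" "s i = s k" "\<And>j. j < n \<Longrightarrow> s j = s i \<Longrightarrow> i \<le> j \<and> j \<le> k"
    using \<open>P q\<close> by (auto simp: P_def q)
  have "s j = s i" if j: "i \<le> j" "j \<le> k" for j
  proof (rule ccontr)
    assume ne: "s j \<noteq> s i"
    then have lt: "i < j" "j < k" using j ik(3) by (auto simp: le_less)
    obtain i' k' where *: "P (i', k')" "i' \<le> j" "j \<le> k'" "s i' = s j"
      using hull[of j] lt ik(2) by auto
    have **: "k' < n" "s i' = s k'" using *(1) by (auto simp: P_def)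
    have "i < i'"
    proof (rule ccontr)
      assume "\<not> i < i'"
      with * ne have "i' < i" by (metis linorder_neqE_nat)
      with nc[of i' i j k] lt ik * ne show False by simp
    qed
    moreover have "k' < k"
    proof (rule ccontr)
      assume "\<not> k' < k"
      with * ** ne ik have "k < k'" by (metis linorder_neqE_nat)
      with nc[of i j k k'] lt ik * ** ne show False by simp
    qed
    moreover have "k - i \<le> k' - i'" using minq[OF *(1)] by (simp add: q)
    ultimately show False using *(2,3) by linarith
  qed
  with ik that show thesis by metis
qed

lemma noncrossing_interval:
  assumes "a \<noteq> []" and nc: "noncrossing (lpart (a @ b) [])"
  obtains X w x Y where "a = X @ mono_line x w @ Y" "w \<noteq> []" "x \<notin> labs X" "x \<notin> labs Y"
proof -
  define B where "B i = {p \<in> pts (a @ b) []. lab (a @ b) [] p = lab (a @ b) [] (Up i)}" for i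
  have bl: "B i \<in> blocks (lpart (a @ b) [])" if "i < length a" for i
    unfolding lpart_sel kerpart_def B_def using that by (intro imageI) (auto simp: pts_def)
  have Bmem: "Up j \<in> B i \<longleftrightarrow> snd (a ! j) = snd (a ! i)" if "i < length a" "j < length a" for i j
    using that by (auto simp: B_def pts_def nth_append)
  have nc': "snd (a ! i) = snd (a ! j)"
    if ijkl: "i < j" "j < k" "k < l" "l < length a" "snd (a ! i) = snd (a ! k)" "snd (a ! j) = snd (a ! l)" for i j k l
  proof (rule ccontr)
    assume ne: "snd (a ! i) \<noteq> snd (a ! j)"
    have mem: "Up i \<in> B i" "Up k \<in> B i" "Up j \<in> B j" "Up l \<in> B j" "Up i \<notin> B j"
      using ijkl ne by (simp_all add: Bmem)
    then have "B i \<noteq> B j" by blast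
    then have "\<not> (\<exists>x\<in>B i. \<exists>y\<in>B j. \<exists>z\<in>B i. \<exists>t\<in>B j. bpos (lpart (a @ b) []) x < bpos (lpart (a @ b) []) y \<and>
        bpos (lpart (a @ b) []) y < bpos (lpart (a @ b) []) z \<and> bpos (lpart (a @ b) []) z < bpos (lpart (a @ b) []) t)"
      using nc bl[of i] bl[of j] ijkl(1-4) unfolding noncrossing_def by (meson dual_order.strict_trans)
    then have "\<not> (bpos (lpart (a @ b) []) (Up i) < bpos (lpart (a @ b) []) (Up j) \<and>
        bpos (lpart (a @ b) []) (Up j) < bpos (lpart (a @ b) []) (Up k) \<and>
        bpos (lpart (a @ b) []) (Up k) < bpos (lpart (a @ b) []) (Up l))"
      using mem by blast
    then show False using ijkl by simp
  qed
  obtain i k where ik: "i \<le> k" "k < length a"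
    "\<And>j. j < length a \<Longrightarrow> snd (a ! j) = snd (a ! i) \<longleftrightarrow> i \<le> j \<and> j \<le> k"
  proof (rule interval_block[of "length a" "\<lambda>i. snd (a ! i)"])
    show "0 < length a" using assms(1) by simp
  qed (use nc' in blast)+
  define V where "V = take (Suc k - i) (drop i a)"
  have a: "a = take i a @ V @ drop (Suc k) a"
  proof -
    have "drop (Suc k) a = drop (Suc k - i) (drop i a)" using ik(1) by simp
    then show ?thesis unfolding V_def by (metis append_take_drop_id)
  qed
  have V: "V = mono_line (snd (a ! i)) (map fst V)"
  proof (rule nth_equalityI)
    fix j assume "j < length V"
    then have "V ! j = a ! (i + j)" "snd (a ! (i + j)) = snd (a ! i)"
      using ik(1,2) by (auto simp: V_def ik(3))
    then show "V ! j = mono_line (snd (a ! i)) (map fst V) ! j"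
      using \<open>j < length V\<close> by (simp add: mono_line_def prod_eq_iff)
  qed simp
  show thesis
  proof (rule that)
    show "a = take i a @ mono_line (snd (a ! i)) (map fst V) @ drop (Suc k) a"
      by (subst (1) a) (subst (1) V, rule refl)
    show "map fst V \<noteq> []" using ik(1,2) by (auto simp: V_def)
    show "snd (a ! i) \<notin> labs (take i a)"
    proof
      assume "snd (a ! i) \<in> labs (take i a)"
      then obtain j where "j < i" "snd (a ! j) = snd (a ! i)" "j < length a" by (auto elim!: labsE)
      with ik(3) show False by auto
    qed
    show "snd (a ! i) \<notin> labs (drop (Suc k) a)"
    proof
      assume "snd (a ! i) \<in> labs (drop (Suc k) a)"
      then obtain j where "j < length (drop (Suc k) a)" "snd (drop (Suc k) a ! j) = snd (a ! i)"
        by (rule labsE)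
      moreover from this have "Suc k + j < length a" by simp
      ultimately show False using ik(3)[of "Suc k + j"] ik(2) by simp
    qed
  qed
qed

context pcat
begin

lemma lequiv_append_disjoint:
  assumes "labs u \<inter> labs v = {}"
  shows "lequiv (u @ v) a \<longleftrightarrow> lequiv (side u v) a"
proof -
  define f where "f x = (if x \<in> labs u then tag0 x else tag1 x)" for x
  have "relab f u = relab tag0 u" "relab f v = relab tag1 v"
    using assms by (auto intro!: relab_cong simp: f_def)
  then have "side u v = relab f (u @ v)" by (simp add: side_def)
  moreover have "inj_on f (labs (u @ v))" by (auto simp: inj_on_def f_def)
  ultimately show ?thesis using lequiv_relab by metis
qed

lemma cls_append_disjoint:
  assumes "labs u \<inter> labs v = {}" "lequiv u u" "lequiv v v"
  shows "cls (u @ v) = cls u \<otimes>\<^bsub>G_group C\<^esub> cls v"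
proof -
  have "lequiv (side u v) (side u v)" using assms by (intro lequiv_side)
  then have "lequiv (u @ v) (side u v)" using lequiv_append_disjoint[OF assms(1)] by blast
  then show ?thesis using assms by (simp add: G_mult cls_cong[of "u @ v"])
qed

lemma cls_in_carrier: "lequiv a a \<Longrightarrow> cls a \<in> carrier (G_group C)"
  by (auto simp: G_carrier)

lemma lequiv_mono_relabel: "lequiv (mono_line x w) a \<longleftrightarrow> lequiv (mono_line y w) a"
  using lequiv_relab[of "\<lambda>_. y" "mono_line x w" a] by (auto simp: inj_on_def split: if_splits)

lemma lequiv_mono_self: "lequiv (mono_line x w) (mono_line x w) \<longleftrightarrow> lequiv (mono_line y w) (mono_line y w)"
  using lequiv_mono_relabel lequiv_sym by metis

lemma L_mono_relabel: "L (mono_line (x :: nat) w) \<longleftrightarrow> L (mono_line (y :: nat) w)"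
  using L_relab[of "\<lambda>_. y" "mono_line x w"] by (auto simp: inj_on_def split: if_splits)

lemma L_cancel: "L (X @ (c, x) # (d, x) # Y) \<Longrightarrow> d = inv_colour c \<Longrightarrow> L (X @ Y)"
  using L_contract_same[of X c x Y] by simp

lemma L_mono_std: "L (X @ mono_line x w @ Y) \<Longrightarrow> L (X @ mono_line x (std (deg w)) @ Y)"
proof (induction w arbitrary: X)
  case (Cons c w)
  have "L ((X @ [(c, x)]) @ mono_line x (std (deg w)) @ Y)"
    by (rule Cons.IH) (use Cons.prems in simp)
  then have *: "L (X @ (c, x) # mono_line x (std (deg w)) @ Y)" by simp
  show ?case
  proof (cases c)
    case White
    show ?thesis
    proof (cases "0 \<le> deg w")
      case False
      then have "L (X @ (White, x) # (Black, x) # mono_line x (tl (std (deg w))) @ Y)"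
        using * White by (subst (asm) std_neg) auto
      from L_cancel[OF this] show ?thesis using False White by (simp add: std_White)
    qed (use * White in \<open>simp add: std_White\<close>)
  next
    case Black
    show ?thesis
    proof (cases "deg w \<le> 0")
      case False
      then have "L (X @ (Black, x) # (White, x) # mono_line x (tl (std (deg w))) @ Y)"
        using * Black by (subst (asm) std_pos) auto
      from L_cancel[OF this] show ?thesis using False Black by (simp add: std_Black)
    qed (use * Black in \<open>simp add: std_Black\<close>)
  qed
qed simp

lemma deg_bar: "deg (rev (map inv_colour w)) = - deg w"
  by (induction w rule: deg.induct) auto

lemma lequiv_std:
  assumes "lequiv a (X @ mono_line x w @ Y)"
  shows "lequiv a (X @ mono_line x (std (deg w)) @ Y)"
proof -
  have "L ((relab tag0 a @ bar (relab tag1 Y)) @ mono_line (tag1 x) (rev (map inv_colour w)) @ bar (relab tag1 X))"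
    using assms by (simp add: lequiv_def side_def)
  from L_mono_std[OF this] show ?thesis
    by (simp add: lequiv_def side_def deg_bar bar_std)
qed

lemma lequiv_theta: "lequiv a (mono_line 0 w) \<Longrightarrow> lequiv a (theta (deg w))"
  using lequiv_std[of a "[]" 0 w "[]"] by (simp add: theta_def)

lemma lequiv_theta_self: "lequiv (mono_line x w) (mono_line x w) \<Longrightarrow> lequiv (theta (deg w)) (theta (deg w))"
  using lequiv_theta lequiv_mono_self[of x w 0] lequiv_refl lequiv_sym by blast

lemma J_iff: "k \<in> J_set C \<longleftrightarrow> lequiv (theta k) (theta k)"
  by (simp add: J_set_def beta_part_eq pairing_iff)

lemma theta_neg: "theta (- k) = bar (theta k)"
  by (simp add: theta_def bar_std)

lemma J_neg: "k \<in> J_set C \<longleftrightarrow> - k \<in> J_set C"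
  using lequiv_bar[of "theta k"] lequiv_bar[of "theta (- k)"] by (auto simp: J_iff theta_neg)

lemma hpower_pairing:
  assumes "lequiv a a"
  obtains b where "hpower (pairing a a) k = pairing b b" "lequiv b b"
    "cls b = cls a [^]\<^bsub>G_group C\<^esub> k"
proof (induction k arbitrary: thesis)
  case 0
  have "hpower (pairing a a) 0 = pairing [] []"
    by (simp add: hpower_def empty_part_def pairing_def lpart_def pts_def kerpart_def)
  with 0[of "[]"] show ?case
    by (simp add: lequiv_empty G_one group.is_monoid[OF group_G] monoid.nat_pow_0)
next
  case (Suc k)
  interpret G: group "G_group C" by (rule group_G)
  obtain b where b: "hpower (pairing a a) k = pairing b b" "lequiv b b"
    "cls b = cls a [^]\<^bsub>G_group C\<^esub> k" by (rule Suc.IH)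
  show ?case
  proof (rule Suc.prems)
    show "hpower (pairing a a) (Suc k) = pairing (side a b) (side a b)"
      using b(1) by (simp add: hpower_def hconcat_pairing)
    show "lequiv (side a b) (side a b)" using assms b(2) by (rule lequiv_side)
    show "cls (side a b) = cls a [^]\<^bsub>G_group C\<^esub> Suc k"
      using assms b G.nat_pow_Suc2[of "cls a" k] by (simp add: G_mult[symmetric] cls_in_carrier)
  qed
qed

lemma trivial_exponent_eq:
  assumes a: "lequiv a a"
  shows "cyclic (trivial_exponent C (pairing a a)) = integer_mod_group (group.ord (G_group C) (cls a))"
proof -
  interpret G: group "G_group C" by (rule group_G)
  let ?d = "G.ord (cls a)"
  have sim: "sim C (hpower (pairing a a) k) empty_part \<longleftrightarrow> ?d dvd k" for k
  proof -
    obtain b where b: "hpower (pairing a a) k = pairing b b" "lequiv b b"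
      "cls b = cls a [^]\<^bsub>G_group C\<^esub> k" by (rule hpower_pairing[OF a])
    have e: "empty_part = pairing [] []"
      by (simp add: empty_part_def pairing_def lpart_def pts_def kerpart_def)
    have "sim C (pairing b b) (pairing [] []) \<longleftrightarrow> lequiv b []"
      unfolding sim_pairing using pairing_eqD(2)[of "[]" "[]"] by auto
    also have "\<dots> \<longleftrightarrow> cls a [^]\<^bsub>G_group C\<^esub> k = \<one>\<^bsub>G_group C\<^esub>"
      unfolding G_one using cls_eq_iff[OF lequiv_empty, of b] b(3) by simp
    also have "\<dots> \<longleftrightarrow> ?d dvd k" using G.pow_eq_id cls_in_carrier a by simp
    finally show ?thesis by (simp add: b(1) e)
  qed
  show ?thesis
  proof (cases "?d = 0")
    case True
    have "trivial_exponent C (pairing a a) = \<infinity>"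
      unfolding trivial_exponent_def sim using True by (auto simp: top_enat_def[symmetric])
    then show ?thesis using True by (simp add: integer_mod_group_def)
  next
    case False
    have "trivial_exponent C (pairing a a) = enat ?d"
      unfolding trivial_exponent_def sim
    proof (rule antisym)
      show "(INF k\<in>{k. 1 \<le> k \<and> ?d dvd k}. enat k) \<le> enat ?d"
        using False by (intro INF_lower) auto
      show "enat ?d \<le> (INF k\<in>{k. 1 \<le> k \<and> ?d dvd k}. enat k)"
        by (intro INF_greatest) (auto dest: dvd_imp_le)
    qed
    then show ?thesis by simp
  qed
qed

subsection \<open>Categories with singletons\<close>

fun singles :: "colour list \<Rightarrow> nat line" where
  "singles [] = []"
| "singles (c # w) = side [(c, 0)] (singles w)"

lemma singles_fst: "map fst (singles w) = w"
  by (induction w) (auto simp: side_def)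

lemma singles_distinct: "distinct (map snd (singles w))"
proof (induction w)
  case (Cons c w)
  have "map snd (relab tag1 xs) = map tag1 (map snd xs)" for xs :: "nat line"
    by (simp add: relab_def)
  with Cons show ?case
    by (auto simp: side_def distinct_map inj_on_def)
qed simp

context
  assumes single: "L [(White, 0 :: nat), (Black, 1)]"
begin

lemma single_pair:
  assumes "x \<noteq> y" shows "L [(c, x :: nat), (inv_colour c, y)]"
proof -
  have inj: "inj_on f {0, 1}" if "f 0 \<noteq> f 1" for f :: "nat \<Rightarrow> nat"
    using that by (auto simp: inj_on_def)
  show ?thesis
  proof (cases c)
    case White
    then show ?thesis
      using single L_relab[of "\<lambda>i. if i = 0 then x else y" "[(White, 0 :: nat), (Black, 1)]"] assms
      by (simp add: inj)
  next
    case Black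
    have "L [(White, y), (Black, x)]"
      using single L_relab[of "\<lambda>i. if i = 0 then y else x" "[(White, 0 :: nat), (Black, 1)]"] assms
      by (simp add: inj)
    then show ?thesis using Black L_rotate[of "[(White, y)]" "[(Black, x)]"] by simp
  qed
qed

text \<open>A pair of singletons is inserted and one of them is contracted with the point to be isolated.\<close>

lemma L_isolate:
  assumes "L (X @ (c, x :: nat) # Y)" "n \<notin> labs (X @ Y)"
  shows "L (X @ (c, n) # Y)"
proof (cases "n = x")
  case False
  obtain q where q: "q \<notin> insert n (insert x (labs (X @ Y)))"
    using ex_new_if_finite[of "insert n (insert x (labs (X @ Y)))"] by (auto simp: infinite_UNIV_nat)
  have "L (X @ [(c, n), (inv_colour c, q)] @ (c, x) # Y)"
    by (rule L_insert) (use assms False q in \<open>auto intro: single_pair\<close>)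
  then have "L ((X @ [(c, n)]) @ (inv_colour c, q) # (inv_colour (inv_colour c), x) # Y)" by simp
  from L_contract[OF this] have "L (relab (id(x := q)) (X @ (c, n) # Y))" by simp
  then show ?thesis
    by (subst (asm) L_relab) (use q in \<open>auto simp: inj_on_def\<close>)
qed (use assms in simp)

lemma L_singles:
  fixes b :: "nat line"
  assumes "L (X @ b @ Y)" "map fst s = map fst b" "distinct (map snd s)"
    "labs s \<inter> labs (X @ b @ Y) = {}"
  shows "L (X @ s @ Y)"
  using assms
proof (induction b arbitrary: X s)
  case (Cons cx b)
  obtain c x where cx: "cx = (c, x)" by fastforce
  obtain n s' where s: "s = (c, n) # s'" using Cons.prems(2) cx by (cases s) auto
  have n: "n \<notin> labs s'" using Cons.prems(3) by (simp add: s labs_def)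
  have "L (X @ (c, n) # b @ Y)"
    by (rule L_isolate[of X c x]) (use Cons.prems cx s in auto)
  have "L ((X @ [(c, n)]) @ s' @ Y)"
    by (rule Cons.IH) (use \<open>L (X @ (c, n) # b @ Y)\<close> Cons.prems cx s n in auto)
  then show ?case by (simp add: s)
qed simp

lemma lequiv_singles:
  assumes "lequiv a b" shows "lequiv a (singles (map fst b))"
proof -
  let ?s = "bar (relab tag1 (relab tag1 (singles (map fst b))))"
  have "L (relab tag0 (relab tag0 a) @ bar (relab tag0 (relab tag1 b)) @ [])"
    using assms L_relab[of tag0 "side a (bar b)"] by (simp add: lequiv_def side_def inj_on_def)
  then have "L (relab tag0 (relab tag0 a) @ ?s @ [])"
  proof (rule L_singles)
    show "map fst ?s = map fst (bar (relab tag0 (relab tag1 b)))"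
      by (simp add: bar_fst singles_fst)
    show "distinct (map snd ?s)"
      using singles_distinct by (auto simp: bar_snd relab_snd distinct_map inj_on_def)
  qed auto
  then show ?thesis
    by (subst lequiv_iff[of "tag0 \<circ> tag0" _ "tag1 \<circ> tag1"]) (auto simp: inj_on_def)
qed

lemma G_singles: "G_group C \<cong> cyclic (trivial_exponent C (pairing [(White, 0)] [(White, 0)]))"
proof -
  interpret G: group "G_group C" by (rule group_G)
  let ?g = "cls [(White, 0)]"
  have w: "lequiv [(White, 0)] [(White, 0)]"
    using single_pair[of "tag0 0" "tag1 0" White] by (simp add: lequiv_def side_def)
  then have b: "lequiv [(Black, 0)] [(Black, 0)]" using lequiv_bar[OF w] by simp
  have g: "?g \<in> carrier (G_group C)" using w by (rule cls_in_carrier)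
  have s: "lequiv (singles v) (singles v) \<and> cls (singles v) \<in> range (\<lambda>k::int. ?g [^]\<^bsub>G_group C\<^esub> k)" for v
  proof (induction v)
    case Nil
    have "cls [] \<in> range (\<lambda>k::int. ?g [^]\<^bsub>G_group C\<^esub> k)"
      by (rule range_eqI[of _ _ 0]) (simp add: G_one)
    then show ?case by (simp add: lequiv_empty)
  next
    case (Cons c v)
    then obtain k :: int where k: "cls (singles v) = ?g [^]\<^bsub>G_group C\<^esub> k" by blast
    have c: "lequiv [(c, 0)] [(c, 0)]" using w b by (cases c) auto
    have "cls [(Black, 0)] = ?g [^]\<^bsub>G_group C\<^esub> (- 1 :: int)"
      using G_inv[OF w] g by (simp add: G.int_pow_neg)
    then have "\<exists>e::int. cls [(c, 0)] = ?g [^]\<^bsub>G_group C\<^esub> e"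
      using g by (cases c) (auto intro: exI[of _ 1])
    then obtain e :: int where e: "cls [(c, 0)] = ?g [^]\<^bsub>G_group C\<^esub> e" by blast
    have "cls (singles (c # v)) = ?g [^]\<^bsub>G_group C\<^esub> (e + k)"
      using c Cons e k g by (simp add: G_mult[symmetric] G.int_pow_mult)
    with Cons c show ?case by (auto intro: lequiv_side)
  qed
  have "carrier (G_group C) = range (\<lambda>k::int. ?g [^]\<^bsub>G_group C\<^esub> k)"
  proof
    show "carrier (G_group C) \<subseteq> range (\<lambda>k::int. ?g [^]\<^bsub>G_group C\<^esub> k)"
    proof
      fix y assume "y \<in> carrier (G_group C)"
      then obtain a where a: "y = cls a" "lequiv a a" by (auto simp: G_carrier)
      from cls_cong[OF lequiv_singles[OF a(2)]] s a(1)
      show "y \<in> range (\<lambda>k::int. ?g [^]\<^bsub>G_group C\<^esub> k)" by metis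
    qed
  qed (use g in auto)
  with g show ?thesis unfolding trivial_exponent_eq[OF w] by (rule G.cyclic_iso_mod)
qed

end

subsection \<open>Categories with four-point blocks\<close>

context
  assumes four: "L (mono_line (0 :: nat) [White, White, Black, Black])"
begin

lemma four_block: "L (mono_line (x :: nat) [c, d, inv_colour d, inv_colour c])"
proof -
  have WWBB: "L (mono_line y [White, White, Black, Black])" for y :: nat
    using four L_mono_relabel[of 0 "[White, White, Black, Black]" y] by simp
  have "L (mono_line (0 :: nat) [White, White, Black, Black] @ mono_line 1 [White, White, Black, Black])"
    using L_insert[of "mono_line (0 :: nat) [White, White, Black, Black]" "[]"
        "mono_line 1 [White, White, Black, Black]"] WWBB by simp
  then have "L (mono_line (0 :: nat) [White, White, Black] @ (Black, 0) # (inv_colour Black, 1) #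
      mono_line 1 [White, Black, Black])" by simp
  from L_contract[OF this] have "L (mono_line (0 :: nat) [White, White, Black, White, Black, Black])"
    by simp
  then have "L ([] @ (Black, 0 :: nat) # (inv_colour Black, 0) # mono_line 0 [White, Black, White, Black])"
    using L_rotate[of "mono_line (0 :: nat) [White, White, Black, White, Black]" "[(Black, 0)]"] by simp
  from L_contract_same[OF this] have "L (mono_line (0 :: nat) [White, Black, White, Black])" by simp
  then have WBWB: "L (mono_line y [White, Black, White, Black])" for y :: nat
    using L_mono_relabel[of 0 "[White, Black, White, Black]" y] by simp
  have "L (mono_line x [Black, White, Black, White])"
    using WBWB[of x] L_rotate[of "[(White, x)]"] by simp
  moreover have "L (mono_line x [Black, Black, White, White])"
    using WWBB[of x] L_rotate[of "[(White, x), (White, x)]"] by simp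
  ultimately show ?thesis using WWBB[of x] WBWB[of x] by (cases c; cases d) simp_all
qed

text \<open>A four-point block is inserted next to the two points and contracted with both of them.\<close>

lemma L_merge:
  assumes "L (X @ (c, x :: nat) # (d, y) # Y)"
  shows "L (relab (id(y := x)) (X @ (c, x) # (d, y) # Y))"
proof -
  let ?Z = "X @ (c, x) # (d, y) # Y"
  obtain n where n: "n \<notin> labs ?Z"
    using ex_new_if_finite[of "labs ?Z"] by (auto simp: infinite_UNIV_nat)
  define f where "f = (id :: nat \<Rightarrow> nat)(x := n)"
  define g where "g = (id :: nat \<Rightarrow> nat)(f y := n)"
  have fg: "f n = n" "f x = n" "g n = n" "g (f y) = n" by (auto simp: f_def g_def)
  have "L (X @ mono_line n [c, d, inv_colour d, inv_colour c] @ (c, x) # (d, y) # Y)"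
    by (rule L_insert) (use assms n four_block in auto)
  then have "L ((X @ mono_line n [c, d, inv_colour d]) @ (inv_colour c, n) #
      (inv_colour (inv_colour c), x) # (d, y) # Y)" by simp
  from L_contract[OF this, folded f_def]
  have "L (relab f X @ mono_line n [c, d, inv_colour d] @ (d, f y) # relab f Y)"
    by (simp add: fg)
  then have "L ((relab f X @ mono_line n [c, d]) @ (inv_colour d, n) # (inv_colour (inv_colour d), f y) # relab f Y)"
    by simp
  from L_contract[OF this, folded g_def] have "L (relab (g \<circ> f) ?Z)"
    by (simp add: fg)
  also have "relab (g \<circ> f) ?Z = relab (id(x := n)) (relab (id(y := x)) ?Z)"
    unfolding relab_simps(8) by (rule relab_cong) (use n in \<open>auto simp: f_def g_def\<close>)
  also have "L \<dots> \<longleftrightarrow> L (relab (id(y := x)) ?Z)"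
    by (rule L_relab) (use n in \<open>auto simp: inj_on_def\<close>)
  finally show ?thesis .
qed

lemma L_merge_all:
  assumes "L (X @ (c, x :: nat) # b @ Y)" "(labs b - {x}) \<inter> labs (X @ Y) = {}"
  shows "L (X @ mono_line x (c # map fst b) @ Y)"
  using assms
proof (induction "length b" arbitrary: X c b)
  case (Suc k)
  obtain d y b' where b: "b = (d, y) # b'" using Suc.hyps(2) by (cases b) auto
  define f where "f = id(y := x)"
  have f: "f x = x" "f y = x" by (auto simp: f_def)
  have XY: "relab f X = X" "relab f Y = Y"
    using Suc.prems(2) by (auto intro!: relab_id simp: b f_def)
  have "L (relab f (X @ (c, x) # (d, y) # b' @ Y))"
    unfolding f_def using Suc.prems(1) by (intro L_merge) (simp add: b)
  then have *: "L ((X @ [(c, x)]) @ (d, x) # relab f b' @ Y)" by (simp add: XY f)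
  have "L ((X @ [(c, x)]) @ mono_line x (d # map fst (relab f b')) @ Y)"
    by (rule Suc.hyps(1)[OF _ *]) (use Suc.prems(2) Suc.hyps(2) in \<open>auto simp: b f_def\<close>)
  then show ?case by (simp add: b)
qed simp

lemma lequiv_one_block:
  assumes "lequiv a b" shows "lequiv a (theta (deg (map fst b)))"
proof (cases "b = []")
  case False
  then have "bar (relab tag1 b) \<noteq> []" by (metis bar_simps(5) length_0_conv relab_simps(5))
  then obtain c x b' where b: "bar (relab tag1 b) = (c, x) # b'" by (metis list.exhaust surj_pair)
  then have "x \<in> labs (bar (relab tag1 b))" by simp
  then obtain z where z: "x = tag1 z" by auto
  have lb: "labs b' \<subseteq> tag1 ` labs b"
    using arg_cong[OF b, of labs] by auto
  have "L (relab tag0 a @ (c, x) # b' @ [])"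
    using assms b by (simp add: lequiv_def side_def)
  then have "L (relab tag0 a @ mono_line x (c # map fst b') @ [])"
    by (rule L_merge_all) (use lb in auto)
  moreover have "c # map fst b' = rev (map inv_colour (map fst b))"
    using arg_cong[OF b, of "map fst"] by (simp add: bar_fst)
  ultimately have "lequiv a (mono_line z (map fst b))"
    by (simp add: lequiv_def side_def z)
  then have "lequiv a (mono_line 0 (map fst b))"
    using lequiv_mono_relabel lequiv_sym by metis
  then show ?thesis by (rule lequiv_theta)
qed (use assms in simp)

lemma cls_theta_mult:
  assumes "lequiv (theta k) (theta k)" "lequiv (theta l) (theta l)"
  shows "cls (theta k) \<otimes>\<^bsub>G_group C\<^esub> cls (theta l) = cls (theta (k + l))"
proof -
  have "lequiv (side (theta k) (theta l)) (side (theta k) (theta l))"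
    using assms by (intro lequiv_side)
  from cls_cong[OF lequiv_one_block[OF this]] show ?thesis
    using assms by (simp add: G_mult) (simp add: side_def theta_def)
qed

lemma G_thetas:
  assumes J: "\<And>k. k \<in> J_set C \<longleftrightarrow> int n dvd k"
  shows "cls (theta (int n)) \<in> carrier (G_group C)"
    and "cls (theta (int n)) [^]\<^bsub>G_group C\<^esub> j = cls (theta (int n * j))"
    and "carrier (G_group C) = range (\<lambda>j::int. cls (theta (int n)) [^]\<^bsub>G_group C\<^esub> j)"
proof -
  interpret G: group "G_group C" by (rule group_G)
  have self: "lequiv (theta (int n * j)) (theta (int n * j))" for j
    using J J_iff by simp
  have pow: "cls (theta (int n * j)) = cls (theta (int n * 1)) [^]\<^bsub>G_group C\<^esub> j" for j
    by (rule G.int_pow_additive) (use self in \<open>auto simp: cls_in_carrier cls_theta_mult distrib_left\<close>)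
  show g: "cls (theta (int n)) \<in> carrier (G_group C)" using self[of 1] by (simp add: cls_in_carrier)
  show "cls (theta (int n)) [^]\<^bsub>G_group C\<^esub> j = cls (theta (int n * j))" using pow by simp
  show "carrier (G_group C) = range (\<lambda>j::int. cls (theta (int n)) [^]\<^bsub>G_group C\<^esub> j)"
  proof
    show "carrier (G_group C) \<subseteq> range (\<lambda>j::int. cls (theta (int n)) [^]\<^bsub>G_group C\<^esub> j)"
    proof
      fix y assume "y \<in> carrier (G_group C)"
      then obtain a where a: "y = cls a" "lequiv a a" by (auto simp: G_carrier)
      have *: "lequiv a (theta (deg (map fst a)))" using a(2) by (rule lequiv_one_block)
      then have "deg (map fst a) \<in> J_set C" using lequiv_refl lequiv_sym J_iff by blast
      then obtain j where "deg (map fst a) = int n * j" using J by (auto simp: dvd_def)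
      then have "y = cls (theta (int n)) [^]\<^bsub>G_group C\<^esub> j"
        using cls_cong[OF *] a(1) pow[of j] by simp
      then show "y \<in> range (\<lambda>j::int. cls (theta (int n)) [^]\<^bsub>G_group C\<^esub> j)" by blast
    qed
  qed (use g in auto)
qed

lemma L_theta_cap: "k \<noteq> 0 \<Longrightarrow> L (theta k) \<longleftrightarrow> L (theta k @ bar (mono_line 0 [White, Black]))"
proof
  assume "k \<noteq> 0" "L (theta k)"
  then obtain c w where w: "std k = c # w" by (metis list.exhaust std_Nil_iff)
  have "L (theta k @ [(White, Suc 0), (inv_colour White, Suc 0)] @ [])"
    by (rule L_insert) (use \<open>L (theta k)\<close> L_pair[of White "Suc 0"] in \<open>auto simp: theta_def\<close>)
  then have "L ([] @ (c, 0) # (mono_line 0 w @ [(White, Suc 0), (Black, Suc 0)]) @ [])"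
    by (simp add: theta_def w)
  then have "L ([] @ mono_line (0 :: nat) (c # map fst (mono_line (0 :: nat) w @ [(White, Suc 0), (Black, Suc 0)])) @ [])"
    by (rule L_merge_all) auto
  then show "L (theta k @ bar (mono_line 0 [White, Black]))" by (simp add: theta_def w)
next
  assume "L (theta k @ bar (mono_line 0 [White, Black]))"
  then have "L (theta k @ (White, 0) # (Black, 0) # [])" by simp
  from L_cancel[OF this] show "L (theta k)" by simp
qed

end

lemma mono_square:
  fixes us ls :: "nat line"
  assumes "w \<noteq> []" "lpart (mono_line x w) (mono_line x w) = vcomp (lpart ls us) (lpart us ls)"
  obtains z where "us = mono_line z w" "z \<in> labs ls"
proof -
  let ?T = "labs ls"
  have eq: "lpart (mono_line x w) (mono_line x w) = lpart (relab (sq ?T 0) us) (relab (sq ?T 1) us)"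
    using assms(2) square_lpart by simp
  note eq' = eq[unfolded lpart_eq_iff]
  then have w: "w = map fst us" by simp
  have sq: "sq ?T 0 (snd (us ! i)) = sq ?T 1 (snd (us ! j))" if "i < length us" "j < length us" for i j
  proof -
    have "Up i \<in> pts (mono_line x w) (mono_line x w)" "Lo j \<in> pts (mono_line x w) (mono_line x w)"
      using that w by (auto simp: pts_def)
    with eq' have "lab (mono_line x w) (mono_line x w) (Up i) = lab (mono_line x w) (mono_line x w) (Lo j) \<longleftrightarrow>
      lab (relab (sq ?T 0) us) (relab (sq ?T 1) us) (Up i) = lab (relab (sq ?T 0) us) (relab (sq ?T 1) us) (Lo j)"
      by blast
    then show ?thesis using that w by (simp add: nth_relab mono_line_def)
  qed
  have *: "snd (us ! i) = snd (us ! j) \<and> snd (us ! i) \<in> ?T" if "i < length us" "j < length us" for i j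
    using sq_eq_iff[THEN iffD1, OF _ _ sq[OF that]] by auto
  have len: "0 < length us" using assms(1) w by auto
  have "us = mono_line (snd (us ! 0)) w"
  proof (rule nth_equalityI)
    fix i assume "i < length us"
    with *[OF this len] w show "us ! i = mono_line (snd (us ! 0)) w ! i"
      by (simp add: mono_line_def prod_eq_iff)
  qed (simp add: w)
  with *[OF len len] that show thesis by blast
qed

lemma mono_lpart_eq: "w \<noteq> [] \<Longrightarrow> lpart (mono_line x w) (mono_line x w) = lpart (mono_line y w) (mono_line y w)"
  using one_block_eq by metis

lemma mono_bar_swap:
  "L (mono_line (x :: nat) w @ bar (mono_line x w')) \<longleftrightarrow> L (mono_line (y :: nat) w' @ bar (mono_line y w))"
proof -
  have "L (mono_line x w @ bar (mono_line x w')) \<longleftrightarrow> L (mono_line x w' @ bar (mono_line x w))"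
    using L_bar[of "mono_line x w @ bar (mono_line x w')"] by (simp only: bar_simps(3,4))
  also have "\<dots> \<longleftrightarrow> L (mono_line y w' @ bar (mono_line y w))"
    using L_mono_relabel[of x "w' @ rev (map inv_colour w)" y] by simp
  finally show ?thesis .
qed

lemma sim_mono_transfer:
  assumes L: "L (mono_line (0 :: nat) w @ bar (mono_line (0 :: nat) w'))" and ne: "w \<noteq> []" "w' \<noteq> []"
    and sim: "sim C (lpart (mono_line (0 :: nat) w) (mono_line (0 :: nat) w)) q"
  shows "sim C (lpart (mono_line (0 :: nat) w') (mono_line (0 :: nat) w')) q"
proof -
  obtain us ls :: "nat line" where r: "lpart us ls \<in> C"
    "lpart (mono_line (0 :: nat) w) (mono_line (0 :: nat) w) = vcomp (lpart ls us) (lpart us ls)"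
    "q = vcomp (lpart us ls) (lpart ls us)" and q: "q \<in> C" "projective q"
    using sim by (rule simE)
  obtain z where z: "us = mono_line z w" "z \<in> labs ls"
    using ne(1) r(2) by (rule mono_square)
  define r' where "r' = lpart (mono_line z w') ls"
  have "L (mono_line z w' @ bar (mono_line z w))" using L mono_bar_swap[of 0 w w' z] by blast
  then have "lpart (mono_line z w') (mono_line z w) \<in> C" by (simp add: lpart_iff)
  then have "vcomp (lpart us ls) (lpart (mono_line z w') (mono_line z w)) \<in> C"
    using r(1) by (intro vcomp_closed) (auto simp: z(1))
  moreover have "vcomp (lpart us ls) (lpart (mono_line z w') (mono_line z w)) = r'"
    unfolding r'_def z(1) by (rule vcomp_lpart_same) (use ne in auto)
  ultimately have r'C: "r' \<in> C" by simp
  have p: "vcomp (reflect r') r' = lpart (mono_line (0 :: nat) w') (mono_line (0 :: nat) w')"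
    using z(2) ne(2) mono_lpart_eq[of w' "3 * z" "0 :: nat"]
    by (simp add: r'_def square_lpart sq_def)
  have q': "vcomp r' (reflect r') = q"
    using ne by (simp add: r'_def square_lpart r(3) z(1))
  have "vcomp (reflect r') r' \<in> C"
    using r'C reflect_closed by (intro vcomp_closed) (auto simp: r'_def)
  moreover have "projective (lpart (mono_line (0 :: nat) w') (mono_line (0 :: nat) w'))"
    by (simp add: projective_def is_partition_lpart vcomp_lpart_same)
  ultimately show ?thesis
    unfolding sim_def using p[symmetric] q q'[symmetric] r'C by auto
qed

lemma sim_mono_imp_L:
  assumes ne: "w \<noteq> []" "w' \<noteq> []"
    and sim: "sim C (lpart (mono_line (0 :: nat) w) (mono_line (0 :: nat) w)) (lpart (mono_line (0 :: nat) w') (mono_line (0 :: nat) w'))"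
  shows "L (mono_line (0 :: nat) w @ bar (mono_line (0 :: nat) w'))"
proof -
  obtain us ls :: "nat line" where r: "lpart us ls \<in> C"
    "lpart (mono_line (0 :: nat) w) (mono_line (0 :: nat) w) = vcomp (lpart ls us) (lpart us ls)"
    "lpart (mono_line (0 :: nat) w') (mono_line (0 :: nat) w') = vcomp (lpart us ls) (lpart ls us)"
    using sim by (rule simE)
  obtain z where z: "us = mono_line z w" "z \<in> labs ls"
    using ne(1) r(2) by (rule mono_square)
  obtain z' where z': "ls = mono_line z' w'" "z' \<in> labs us"
    using ne(2) r(3) by (rule mono_square)
  have "z' = z" using z z' ne by simp
  then have "L (mono_line z w @ bar (mono_line z w'))"
    using r(1) by (simp add: z(1) z'(1) lpart_iff)
  then show ?thesis
    using L_mono_relabel[of z "w @ rev (map inv_colour w')" 0] by simp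
qed

lemma projective_mono: "projective (lpart (mono_line x w) (mono_line x w))"
  by (simp add: projective_def is_partition_lpart vcomp_lpart_same)

lemma L_theta_iff_multiples:
  assumes four: "L (mono_line (0 :: nat) [White, White, Black, Black])"
    and I: "I_set C = UNIV - {0}" and S: "S_is_cyclic C s"
  shows "L (theta k) \<longleftrightarrow> k \<in> multiples s"
proof (cases "k = 0")
  case True
  then show ?thesis by (cases s) (auto simp: empty_L)
next
  case False
  let ?p = "lpart (theta k) (theta k)" and ?q = "lpart (mono_line (0 :: nat) [White, Black]) (mono_line (0 :: nat) [White, Black])"
  have pi0: "pi_part 0 = ?q" using one_block_eq[of "[White, Black]" "[White, Black]" "0 :: nat"] by (simp add: pi_part_def)
  have "k \<in> I_set C" using I False by simp
  then have "?p \<in> C" using pi_part_eq[OF False] by (simp add: I_set_def)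
  moreover have "projective ?p" by (simp add: theta_def projective_mono)
  ultimately have refl: "sim C ?p ?p" by (rule sim_refl)
  have ne: "std k \<noteq> []" "[White, Black] \<noteq> []" using False by auto
  have "k \<in> multiples s \<longleftrightarrow> sim_class C ?p = sim_class C ?q"
  proof -
    have "k \<in> multiples s \<longleftrightarrow> k \<in> kernel integer_group (S_fusion C) (\<lambda>k. sim_class C (pi_part k))"
      using S by (simp add: S_is_cyclic_def)
    also have "\<dots> \<longleftrightarrow> sim_class C (pi_part k) = sim_class C (pi_part 0)"
      by (simp add: kernel_def S_fusion_def)
    finally show ?thesis using False by (simp add: pi_part_eq pi0)
  qed
  also have "\<dots> \<longleftrightarrow> L (theta k @ bar (mono_line (0 :: nat) [White, Black]))"
  proof
    assume "sim_class C ?p = sim_class C ?q"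
    then have "sim C ?q ?p" using refl by (auto simp: sim_class_def)
    then have "L (mono_line (0 :: nat) [White, Black] @ bar (mono_line (0 :: nat) (std k)))"
      unfolding theta_def using ne by (intro sim_mono_imp_L)
    then show "L (theta k @ bar (mono_line (0 :: nat) [White, Black]))"
      unfolding theta_def using mono_bar_swap[of 0 "[White, Black]" "std k" 0] by blast
  next
    assume "L (theta k @ bar (mono_line (0 :: nat) [White, Black]))"
    then have *: "L (mono_line (0 :: nat) (std k) @ bar (mono_line (0 :: nat) [White, Black]))" by (simp only: theta_def)
    then have "L (mono_line (0 :: nat) [White, Black] @ bar (mono_line (0 :: nat) (std k)))"
      using mono_bar_swap[of 0 "[White, Black]" "std k" 0] by blast
    with * ne show "sim_class C ?p = sim_class C ?q"
      unfolding sim_class_def theta_def using sim_mono_transfer by blast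
  qed
  also have "\<dots> \<longleftrightarrow> L (theta k)" using L_theta_cap[OF four False] by simp
  finally show ?thesis by simp
qed

lemma G_trivial:
  assumes "\<And>a. lequiv a a \<Longrightarrow> cls a = cls []"
  shows "G_group C \<cong> cyclic 1"
proof -
  interpret G: group "G_group C" by (rule group_G)
  have "carrier (G_group C) = {\<one>\<^bsub>G_group C\<^esub>}"
    using assms lequiv_empty unfolding G_carrier G_one by blast
  then have "carrier (G_group C) = range (\<lambda>k::int. \<one>\<^bsub>G_group C\<^esub> [^]\<^bsub>G_group C\<^esub> k)" by auto
  then have "G_group C \<cong> integer_mod_group (G.ord \<one>\<^bsub>G_group C\<^esub>)"
    by (intro G.cyclic_iso_mod) auto
  then show ?thesis by (simp add: one_enat_def)
qed

lemma G_four_blocks: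
  assumes I: "I_set C = UNIV - {0}" and s: "1 \<le> s" and S: "S_is_cyclic C s"
    and J: "J_set C = {k. int n dvd k}"
  shows "(1 \<le> n \<longrightarrow> (\<exists>d. s = d * enat n \<and> G_group C \<cong> cyclic d)) \<and> (n = 0 \<longrightarrow> G_group C \<cong> cyclic 1)"
proof -
  interpret G: group "G_group C" by (rule group_G)
  have std2: "std 2 = [White, White]" by (simp add: std_def numeral_2_eq_2)
  have "2 \<in> I_set C" using I by simp
  then have "pi_part 2 \<in> C" by (simp add: I_set_def)
  then have four: "L (mono_line (0 :: nat) [White, White, Black, Black])"
    by (simp add: pi_part_eq lpart_iff theta_def std2)
  have J': "k \<in> J_set C \<longleftrightarrow> int n dvd k" for k by (simp add: J)
  let ?g = "cls (theta (int n))"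
  note g = G_thetas[OF four J']
  have iso: "G_group C \<cong> integer_mod_group (G.ord ?g)"
    using g(1,3) by (rule G.cyclic_iso_mod)
  have ord: "int (G.ord ?g) dvd j \<longleftrightarrow> int n * j \<in> multiples s" for j
  proof -
    have "int (G.ord ?g) dvd j \<longleftrightarrow> ?g [^]\<^bsub>G_group C\<^esub> j = \<one>\<^bsub>G_group C\<^esub>"
      using G.int_pow_eq_id g(1) by simp
    also have "\<dots> \<longleftrightarrow> lequiv (theta (int n * j)) []"
      unfolding g(2) G_one by (rule cls_eq_iff[OF lequiv_empty])
    also have "\<dots> \<longleftrightarrow> int n * j \<in> multiples s"
      using L_theta_iff_multiples[OF four I S] by (simp add: lequiv_Nil)
    finally show ?thesis .
  qed
  show ?thesis
  proof (intro conjI impI)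
    assume n: "1 \<le> n"
    show "\<exists>d. s = d * enat n \<and> G_group C \<cong> cyclic d"
    proof (cases s)
      case infinity
      then have "G.ord ?g = 0" using ord[of "int (G.ord ?g)"] n by auto
      then have "G_group C \<cong> cyclic \<infinity>" using iso by (simp add: integer_mod_group_def)
      moreover have "s = \<infinity> * enat n" using infinity n by (simp add: imult_is_infinity zero_enat_def)
      ultimately show ?thesis by blast
    next
      case (enat m)
      then have "m \<noteq> 0" using s by (auto simp: one_enat_def)
      have "L (theta (int m))" using L_theta_iff_multiples[OF four I S] by (simp add: enat)
      then have "lequiv (theta (int m)) (theta (int m))" using lequiv_Nil lequiv_refl by blast
      then have "int n dvd int m" using J' J_iff by blast
      then obtain d where d: "m = n * d" by auto
      have "int (G.ord ?g) dvd j \<longleftrightarrow> int d dvd j" for j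
        using ord[of j] n by (simp add: enat d)
      from this[of "int d"] this[of "int (G.ord ?g)"] have "G.ord ?g = d"
        by (simp add: dvd_antisym)
      with iso have "G_group C \<cong> cyclic (enat d)" by simp
      moreover have "s = enat d * enat n" by (simp add: enat d)
      ultimately show ?thesis by blast
    qed
  next
    assume "n = 0"
    then have "int (G.ord ?g) dvd 1" using ord[of 1] by (cases s) auto
    then have "G.ord ?g = 1" by simp
    with iso show "G_group C \<cong> cyclic 1" by (simp add: one_enat_def)
  qed
qed

subsection \<open>Categories without singletons and four-point blocks\<close>

lemma interval_theta:
  assumes "L (X @ mono_line (x :: nat) w @ Y)" "x \<notin> labs X" "x \<notin> labs Y"
  shows "lequiv (theta (deg w)) (theta (deg w))"
proof -
  let ?r = "lpart (mono_line x w) (bar (Y @ X))"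
  have "L (mono_line x w @ bar (bar (Y @ X)))"
    using assms(1) L_rotate[of X "mono_line x w @ Y"] by (simp only: append_assoc bar_simps(4))
  then have r: "?r \<in> C" by (simp only: lpart_iff)
  have "vcomp (reflect ?r) ?r \<in> C"
    using r reflect_closed by (intro vcomp_closed) auto
  moreover have "vcomp (reflect ?r) ?r = pairing (mono_line x w) (mono_line x w)"
    unfolding reflect_lpart by (rule square_lpart_disjoint) (use assms in auto)
  ultimately have "lequiv (mono_line x w) (mono_line x w)" by (simp add: pairing_iff)
  then show ?thesis by (rule lequiv_theta_self)
qed

lemma four_of_theta:
  assumes "lequiv (theta d) (theta d)" "3 \<le> d"
  shows "L (mono_line (0 :: nat) [White, White, Black, Black])"
proof -
  define e where "e = nat d - 3"
  have "nat d = Suc (Suc (Suc e))" using assms(2) unfolding e_def by linarith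
  then have std: "std d = [White, White, White] @ replicate e White"
    using assms(2) by (simp add: std_def)
  let ?x = "tag0 0"
  let ?t = "(White, ?x) # mono_line ?x (replicate e White) @ bar (mono_line (tag1 0) (std d))"
  have "L (mono_line ?x [White, White] @ ?t)"
    using assms(1) by (simp add: lequiv_def side_def theta_def std)
  then have r: "lpart (mono_line ?x [White, White]) (bar ?t) \<in> C"
    using lpart_iff[of "mono_line ?x [White, White]" "bar ?t"] by (simp only: bar_simps(4))
  have x: "?x \<in> labs (bar ?t)" unfolding bar_simps(6) by simp
  have "vcomp (lpart (bar ?t) (mono_line ?x [White, White])) (lpart (mono_line ?x [White, White]) (bar ?t)) \<in> C"
    using r reflect_closed by (intro vcomp_closed) auto
  also have "vcomp (lpart (bar ?t) (mono_line ?x [White, White])) (lpart (mono_line ?x [White, White]) (bar ?t))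
      = lpart (mono_line (3 * ?x) [White, White]) (mono_line (3 * ?x) [White, White])"
    using x unfolding square_lpart relab_simps mono_line_simps(6) by (simp only: sq_def if_True)
  finally have "L (mono_line (3 * ?x) [White, White, Black, Black])"
    by (simp add: lpart_iff)
  then show ?thesis using L_mono_relabel[of "3 * ?x" _ 0] by blast
qed

context
  assumes pair: "lequiv (theta 2) (theta 2)"
begin

lemma pair_pair:
  assumes "x \<noteq> y" shows "L [(c, x :: nat), (c, x), (inv_colour c, y), (inv_colour c, y)]"
proof -
  have std2: "std 2 = [White, White]" by (simp add: std_def numeral_2_eq_2)
  have W: "L [(White, u), (White, u), (Black, v), (Black, v)]" if "u \<noteq> v" for u v :: nat
  proof -
    have "L [(White, tag0 0), (White, tag0 0), (Black, tag1 0), (Black, tag1 0)]"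
      using pair by (simp add: lequiv_def side_def theta_def std2)
    then show ?thesis
      using L_relab[of "\<lambda>i. if i = tag0 0 then u else v" "[(White, tag0 0), (White, tag0 0), (Black, tag1 0), (Black, tag1 0)]"] that
      by (simp add: inj_on_def)
  qed
  show ?thesis
  proof (cases c)
    case Black
    then show ?thesis using W[of y x] assms L_rotate[of "[(White, y), (White, y)]"] by simp
  qed (use W assms in simp)
qed

lemma L_absorb:
  assumes "L (X @ (c, x :: nat) # (c, x) # (inv_colour c, y) # Y)" "x \<noteq> y" "x \<notin> labs (X @ Y)"
  shows "L (X @ (c, y) # Y)"
proof -
  let ?Z = "X @ (c, y) # Y"
  have "L ((X @ [(c, x)]) @ (c, x) # (inv_colour c, y) # Y)" using assms(1) by simp
  from L_contract[OF this] have "L (relab (id(y := x)) (X @ (c, x) # Y))" by simp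
  also have "relab (id(y := x)) (X @ (c, x) # Y) = relab (id(y := x)) ?Z" using assms(2) by simp
  finally show ?thesis
    by (subst (asm) L_relab) (use assms(2,3) in \<open>auto simp: inj_on_def\<close>)
qed

lemma L_emit:
  assumes "L (X @ (c, y :: nat) # Y)" "m \<noteq> y" "m \<notin> labs (X @ Y)"
  shows "L (X @ (inv_colour c, y) # (c, m) # (c, m) # Y)"
proof -
  let ?Z = "X @ (c, y) # Y"
  obtain n where n: "n \<notin> insert m (labs ?Z)"
    using ex_new_if_finite[of "insert m (labs ?Z)"] by (auto simp: infinite_UNIV_nat)
  have "L ((X @ [(c, y)]) @ [(inv_colour c, n), (inv_colour c, n), (c, m), (c, m)] @ Y)"
    by (rule L_insert) (use assms n pair_pair[of n m "inv_colour c"] in auto)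
  then have "L (X @ (c, y) # (inv_colour c, n) # (inv_colour c, n) # (c, m) # (c, m) # Y)" by simp
  from L_contract[OF this] have "L (relab (id(n := y)) (X @ (inv_colour c, n) # (c, m) # (c, m) # Y))" .
  moreover have "relab (id(n := y)) X = X" "relab (id(n := y)) Y = Y"
    using n by (auto intro!: relab_id)
  ultimately show ?thesis using n by simp
qed

lemma L_swap:
  assumes "L (X @ (c, x :: nat) # (c, x) # (d, y) # Y)" "x \<noteq> y" "x \<notin> labs (X @ Y)"
  shows "L (X @ (d, y) # (c, x) # (c, x) # Y)"
proof (cases "d = c")
  case False
  then have d: "d = inv_colour c" by (cases c; cases d) auto
  have "L (X @ (c, y) # Y)" by (rule L_absorb) (use assms d in auto)
  from L_emit[OF this, of x] show ?thesis using assms d by auto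
next
  case True
  let ?Z = "X @ (c, x) # (c, x) # (d, y) # Y"
  obtain m where m: "m \<notin> labs ?Z"
    using ex_new_if_finite[of "labs ?Z"] by (auto simp: infinite_UNIV_nat)
  have "L ((X @ [(c, x), (c, x)]) @ (inv_colour c, y) # (c, m) # (c, m) # Y)"
    by (rule L_emit) (use assms m True in auto)
  then have "L (X @ (c, x) # (c, x) # (inv_colour c, y) # (c, m) # (c, m) # Y)" by simp
  then have "L (X @ (c, y) # (c, m) # (c, m) # Y)"
    by (rule L_absorb) (use assms m in auto)
  then have "L (relab (id(m := x)) (X @ (c, y) # (c, m) # (c, m) # Y))"
    by (subst L_relab) (use assms m in \<open>auto simp: inj_on_def\<close>)
  moreover have "relab (id(m := x)) X = X" "relab (id(m := x)) Y = Y"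
    using m by (auto intro!: relab_id)
  ultimately show ?thesis using m True by simp
qed

lemma L_move:
  assumes "L (X @ (c, x :: nat) # (c, x) # B @ Y)" "x \<notin> labs (X @ B @ Y)"
  shows "L (X @ B @ (c, x) # (c, x) # Y)"
  using assms
proof (induction B arbitrary: X)
  case (Cons dy B)
  obtain d y where dy: "dy = (d, y)" by fastforce
  have "L (X @ (d, y) # (c, x) # (c, x) # B @ Y)"
    by (rule L_swap) (use Cons.prems dy in auto)
  then have "L ((X @ [(d, y)]) @ B @ (c, x) # (c, x) # Y)"
    by (intro Cons.IH) (use Cons.prems dy in auto)
  then show ?case by (simp add: dy)
qed simp

lemma lequiv_pair_front:
  assumes "lequiv a (X @ [(c, x), (c, x)] @ Y)" "x \<notin> labs (X @ Y)"
  shows "lequiv a ([(c, x), (c, x)] @ X @ Y)"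
proof -
  let ?c = "inv_colour c" and ?x = "tag1 x"
  have "L ((relab tag0 a @ bar (relab tag1 Y)) @ (?c, ?x) # (?c, ?x) # bar (relab tag1 X) @ [])"
    using assms(1) by (simp add: lequiv_def side_def)
  then have "L ((relab tag0 a @ bar (relab tag1 Y)) @ bar (relab tag1 X) @ (?c, ?x) # (?c, ?x) # [])"
    by (rule L_move) (use assms(2) in auto)
  then show ?thesis by (simp add: lequiv_def side_def)
qed

end

lemma lequiv_remove_pair:
  assumes "lequiv ([(c, x), (c, x)] @ b) ([(c, x), (c, x)] @ b)" "x \<notin> labs b"
  shows "lequiv b b"
proof -
  let ?c = "inv_colour c" and ?Z = "relab tag0 b @ bar (relab tag1 b)"
  have "L (((c, tag0 x) # (c, tag0 x) # ?Z) @ [(?c, tag1 x), (?c, tag1 x)])"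
    using assms(1) by (simp add: lequiv_def side_def)
  then have "L ([(?c, tag1 x), (?c, tag1 x)] @ ((c, tag0 x) # (c, tag0 x) # ?Z))"
    by (subst L_rotate)
  then have "L ([(?c, tag1 x)] @ (?c, tag1 x) # (inv_colour ?c, tag0 x) # ((c, tag0 x) # ?Z))" by simp
  from L_contract[OF this]
  have "L ((?c, tag1 x) # (c, tag1 x) # relab (id(tag0 x := tag1 x)) ?Z)" by simp
  moreover have "relab (id(tag0 x := tag1 x)) ?Z = ?Z"
    using assms(2) by (intro relab_id) auto
  ultimately have "L ([] @ (?c, tag1 x) # (inv_colour ?c, tag1 x) # ?Z)" by simp
  from L_contract_same[OF this] show ?thesis by (simp add: lequiv_def side_def)
qed

context
  assumes nc: "\<And>p. p \<in> C \<Longrightarrow> noncrossing p"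
    and no_single: "1 \<notin> J_set C"
    and no_four: "\<not> L (mono_line (0 :: nat) [White, White, Black, Black])"
begin

lemma J_bounded: "d \<in> J_set C \<Longrightarrow> d = 0 \<or> d = 2 \<or> d = - 2"
proof -
  have *: "d = 0 \<or> d = 2" if "d \<in> J_set C" "0 \<le> d" for d
  proof -
    have "\<not> 3 \<le> d" using four_of_theta no_four that(1) J_iff by blast
    moreover have "d \<noteq> 1" using no_single that(1) by blast
    ultimately show ?thesis using that(2) by linarith
  qed
  assume "d \<in> J_set C"
  with *[of d] *[of "- d"] J_neg[of d] show ?thesis by force
qed

lemma cls_pairs:
  assumes "lequiv a a"
  shows "if 2 \<in> J_set C then cls a \<in> range (\<lambda>k::int. cls (theta 2) [^]\<^bsub>G_group C\<^esub> k) else cls a = cls []"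
  using assms
proof (induction "length a" arbitrary: a rule: less_induct)
  case less
  interpret G: group "G_group C" by (rule group_G)
  let ?g = "cls (theta 2)"
  let ?R = "range (\<lambda>k::int. ?g [^]\<^bsub>G_group C\<^esub> k)"
  show ?case
  proof (cases "a = []")
    case True
    have "cls [] \<in> ?R" by (rule range_eqI[of _ _ 0]) (simp add: G_one)
    then show ?thesis using True by simp
  next
    case False
    let ?a = "relab tag0 a"
    have La: "L (?a @ bar (relab tag1 a))" using less.prems by (simp add: lequiv_def side_def)
    then have "noncrossing (lpart (?a @ bar (relab tag1 a)) [])" using nc by (simp add: L_def)
    with False obtain X w x Y where a: "?a = X @ mono_line x w @ Y" and w: "w \<noteq> []"
      and x: "x \<notin> labs X" "x \<notin> labs Y"
      using noncrossing_interval[of ?a] by (metis length_0_conv relab_simps(5))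
    have "x \<in> labs ?a" using w unfolding a by simp
    then obtain z where z: "x = tag0 z" by auto
    define d where "d = deg w"
    have "L (X @ mono_line x w @ (Y @ bar (relab tag1 a)))" using La unfolding a by simp
    then have th: "lequiv (theta d) (theta d)"
      unfolding d_def by (rule interval_theta) (use x z in auto)
    have aa: "lequiv ?a a" using less.prems lequiv_self_relab by (simp add: inj_on_def)
    have "lequiv a ?a" using aa by (rule lequiv_sym)
    then have ad: "lequiv a (X @ mono_line x (std d) @ Y)"
      unfolding a d_def by (rule lequiv_std)
    define b where "b = X @ Y"
    have "length ?a = length b + length w" by (simp add: a b_def del: relab_simps)
    then have len: "length b < length a" using w by simp
    from J_bounded th J_iff consider "d = 0" | "d = 2 \<or> d = - 2" by blast
    then show ?thesis
    proof cases
      case 1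
      then have ab: "lequiv a b" using ad by (simp add: b_def)
      then have "lequiv b b" using lequiv_refl lequiv_sym by blast
      with less.hyps[OF len] cls_cong[OF ab] show ?thesis by simp
    next
      case 2
      then have J2: "2 \<in> J_set C" using th J_iff J_neg[of 2] by auto
      then have pair: "lequiv (theta 2) (theta 2)" using J_iff by simp
      obtain c where c: "std d = [c, c]" using 2 by (auto simp: std_def numeral_2_eq_2)
      let ?u = "[(c, x), (c, x)]"
      have ub: "lequiv a (?u @ b)"
        unfolding b_def by (rule lequiv_pair_front[OF pair]) (use ad c x in auto)
      then have "lequiv (?u @ b) (?u @ b)" using lequiv_refl lequiv_sym by blast
      then have b: "lequiv b b" by (rule lequiv_remove_pair) (use x in \<open>simp add: b_def\<close>)
      have u: "?u = mono_line x (std d)" by (simp add: c)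
      have uu: "lequiv ?u ?u" unfolding u using th lequiv_mono_self[of x "std d" 0] by (simp add: theta_def)
      have ut: "lequiv ?u (theta d)" using th lequiv_mono_relabel[of x "std d" _ 0] unfolding u theta_def by blast
      have g: "?g \<in> carrier (G_group C)" using pair by (rule cls_in_carrier)
      have "cls (theta (- 2)) = ?g [^]\<^bsub>G_group C\<^esub> (- 1 :: int)"
        using G_inv[OF pair] theta_neg[of 2] g by (simp add: G.int_pow_neg)
      moreover have "?g = ?g [^]\<^bsub>G_group C\<^esub> (1 :: int)" using g by simp
      ultimately obtain e :: int where e: "cls ?u = ?g [^]\<^bsub>G_group C\<^esub> e"
        using 2 cls_cong[OF ut] by metis
      obtain k :: int where k: "cls b = ?g [^]\<^bsub>G_group C\<^esub> k"
        using less.hyps[OF len b] J2 by auto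
      have "cls (?u @ b) = cls ?u \<otimes>\<^bsub>G_group C\<^esub> cls b"
        by (rule cls_append_disjoint) (use x uu b in \<open>auto simp: b_def\<close>)
      then have "cls a = ?g [^]\<^bsub>G_group C\<^esub> (e + k)"
        using cls_cong[OF ub] e k g by (simp add: G.int_pow_mult)
      with J2 show ?thesis by simp
    qed
  qed
qed

lemma G_pairs:
  "(2 \<in> J_set C \<longrightarrow> G_group C \<cong> cyclic (trivial_exponent C (beta_part 2))) \<and>
   (2 \<notin> J_set C \<longrightarrow> G_group C \<cong> cyclic 1)"
proof (intro conjI impI)
  interpret G: group "G_group C" by (rule group_G)
  assume J2: "2 \<in> J_set C"
  then have pair: "lequiv (theta 2) (theta 2)" using J_iff by simp
  have g: "cls (theta 2) \<in> carrier (G_group C)" using pair by (rule cls_in_carrier)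
  have "carrier (G_group C) = range (\<lambda>k::int. cls (theta 2) [^]\<^bsub>G_group C\<^esub> k)"
  proof
    show "carrier (G_group C) \<subseteq> range (\<lambda>k::int. cls (theta 2) [^]\<^bsub>G_group C\<^esub> k)"
      using cls_pairs J2 by (auto simp: G_carrier)
  qed (use g in auto)
  with g show "G_group C \<cong> cyclic (trivial_exponent C (beta_part 2))"
    unfolding beta_part_eq trivial_exponent_eq[OF pair] by (rule G.cyclic_iso_mod)
next
  assume "2 \<notin> J_set C"
  then show "G_group C \<cong> cyclic 1" using cls_pairs by (intro G_trivial) auto
qed

end

end

theorem theorem5p6:
  fixes C :: "tcp set"
  assumes "nc_category C"
  shows
    "(\<forall>(s::enat) (n::nat).
        I_set C = UNIV - {0} \<and> 1 \<le> s \<and> S_is_cyclic C s \<and> J_set C = {k. int n dvd k} \<longrightarrow>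
          (1 \<le> n \<longrightarrow> (\<exists>d. s = d * enat n \<and> G_group C \<cong> cyclic d)) \<and>
          (n = 0 \<longrightarrow> G_group C \<cong> cyclic 1))
     \<and> (I_set C = {-1, 1} \<and> 1 \<in> J_set C \<longrightarrow>
          G_group C \<cong> cyclic (trivial_exponent C (beta_part 1)))
     \<and> (I_set C = {-1, 1} \<and> 1 \<notin> J_set C \<longrightarrow>
          (2 \<in> J_set C \<longrightarrow> G_group C \<cong> cyclic (trivial_exponent C (beta_part 2))) \<and>
          (2 \<notin> J_set C \<longrightarrow> G_group C \<cong> cyclic 1))"
proof -
  interpret pcat C
    using assms by unfold_locales (simp add: nc_category_def)
  have "G_group C \<cong> cyclic (trivial_exponent C (beta_part 1))" if "1 \<in> J_set C"
  proof -
    have th: "theta 1 = [(White, 0)]" by (simp add: theta_def std_def)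
    have "lequiv [(White, 0)] [(White, 0)]" using that J_iff th by simp
    then have "L [(White, tag0 0), (Black, tag1 0)]" by (simp add: lequiv_def side_def)
    then have "L [(White, 0 :: nat), (Black, 1)]" by (simp add: tag0_def tag1_def)
    from G_singles[OF this] show ?thesis by (simp add: beta_part_eq th)
  qed
  moreover have "(2 \<in> J_set C \<longrightarrow> G_group C \<cong> cyclic (trivial_exponent C (beta_part 2))) \<and>
          (2 \<notin> J_set C \<longrightarrow> G_group C \<cong> cyclic 1)" if "I_set C = {-1, 1}" "1 \<notin> J_set C"
  proof (rule G_pairs)
    show "noncrossing p" if "p \<in> C" for p using assms that by (simp add: nc_category_def)
    have "std 2 = [White, White]" by (simp add: std_def numeral_2_eq_2)
    moreover have "2 \<notin> I_set C" using that(1) by simp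
    then have "pi_part 2 \<notin> C" by (simp add: I_set_def)
    ultimately show "\<not> L (mono_line (0 :: nat) [White, White, Black, Black])"
      by (simp add: pi_part_eq lpart_iff theta_def)
  qed (rule that(2))
  ultimately show ?thesis using G_four_blocks by blast
qed

end
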